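(* Let $n\in\mathbb N$ and $\alpha>0$. For every function $f\in B\mathcal S_{\mathbf M}$ with a Fourier series of the form $(F)$ (see context), $$E_{\lambda_n}(f)_{\mathbf M}\le\frac{1}{2^{\alpha/2}I_n(\alpha/2)}\int_0^\pi\omega_\alpha\Big(f,\frac{u}{\lambda_n}\Big)_{\mathbf M}\sin u\,du,\qquad( * )$$ where $$I_n\Big(\frac\alpha2\Big)=\inf_{k\in\mathbb N,\ k\ge n}\int_0^\pi\Big(1-\cos\frac{\lambda_ku}{\lambda_n}\Big)^{\alpha/2}\sin u\,du.$$ If, in addition, $\alpha/2\in\mathbb N$, then $$I_n\Big(\frac\alpha2\Big)=\frac{2^{\alpha/2+1}}{\alpha/2+1},$$ and inequality $( * )$ cannot be improved for any $n\in\mathbb N$; that is, for each $n\in\mathbb N$ the resulting constant $\dfrac{\alpha/2+1}{2^{\alpha+1}}$ in front of the integral in $( * )$ cannot be replaced by a smaller one valid for all such $f$.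
   Context: Almost periodic functions. A locally Lebesgue integrable $f:\mathbb R\to\mathbb C$ is called $B$-a.p. (Besicovitch almost periodic of order 1) if there are trigonometric sums $\tau_N(x)=\sum_{k} a_k e^{i\mu_k x}$ (finite sums, $\mu_k\in\mathbb R$, $a_k\in\mathbb C$) with $\limsup_{T\to\infty}\frac1{2T}\int_{-T}^T|f-\tau_N|\,dx\to0$ as $N\to\infty$. For such $f$ the mean value $A\{f\}=\lim_{T\to\infty}\frac1T\int_0^Tf(x)\,dx$ exists, and the Fourier exponents of $f$ are the (at most countably many) $\lambda\in\mathbb R$ with $A\{f(\cdot)e^{-i\lambda\cdot}\}\ne0$. Exponents. $\{\lambda_k\}_{k\in\mathbb Z}$ is a real sequence with $\lambda_0=0$, $\lambda_{-k}=-\lambda_k$, $0<\lambda_k<\lambda_{k+1}$ for $k\ge1$, and $\lambda_k\to\infty$ as $k\to\infty$. All functions considered are $B$-a.p. with all Fourier exponents in $\{\lambda_k\}_{k\in\mathbb Z}$; put $A_k(f)=A\{f(\cdot)e^{-i\lambda_k\cdot}\}$. We say $f$ has a Fourier series of the form $(F)$ if its Fourier series is $\sum_{k\in\mathbb Z}A_k(f)e^{i\lambda_kx}$ with $|A_k(f)|+|A_{-k}(f)|>0$ for all $k\ge 1$. The space. $\mathbf M=\{M_k\}_{k\in\mathbb Z}$ is a sequence of Orlicz functions: each $M_k:[0,\infty)\to[0,\infty)$ is nondecreasing and convex, $M_k(0)=0$, $M_k(t)\to\infty$ as $t\to\infty$. Let $M_k^*(v)=\sup\{uv-M_k(u):u\ge0\}$,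 and let $\Gamma$ be the set of sequences of positive numbers $\gamma=\{\gamma_k\}_{k\in\mathbb Z}$ with $\sum_{k\in\mathbb Z}M_k^*(\gamma_k)\le1$. The space $B\mathcal S_{\mathbf M}$ consists of those functions $f$ for which $\|f\|_{\mathbf M}:=\sup\{\sum_{k\in\mathbb Z}\gamma_k|A_k(f)|:\gamma\in\Gamma\}<\infty$; functions with the same Fourier series are identified. Best approximation. $E_{\lambda_n}(f)_{\mathbf M}=\inf\|f-g\|_{\mathbf M}$, the infimum over all $g$ whose Fourier exponents lie in the interval $(-\lambda_n,\lambda_n)$. Modulus of smoothness of order $\alpha>0$. With $\varphi_\alpha(t)=2^{\alpha/2}(1-\cos t)^{\alpha/2}=2^\alpha|\sin(t/2)|^\alpha$, for $\delta\ge0$, $$\omega_\alpha(f,\delta)_{\mathbf M}=\sup_{|h|\le\delta}\ \sup\Big\{\sum_{k\in\mathbb Z}\gamma_k\varphi_\alpha(\lambda_kh)|A_k(f)|:\gamma\in\Gamma\Big\}.$$ *)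

theory Defs
  imports "HOL-Analysis.Analysis"
begin

section \<open>Besicovitch almost periodic functions\<close>

definition trig_sum :: "(real \<Rightarrow> complex) \<Rightarrow> bool" where
  "trig_sum \<tau> \<longleftrightarrow> (\<exists>(m::nat) (a::nat \<Rightarrow> complex) (\<mu>::nat \<Rightarrow> real).
     \<tau> = (\<lambda>x. \<Sum>k<m. a k * exp (\<i> * of_real (\<mu> k * x))))"

definition B_ap :: "(real \<Rightarrow> complex) \<Rightarrow> bool" where
  "B_ap f \<longleftrightarrow> (\<forall>a b. f absolutely_integrable_on {a..b}) \<and>
     (\<exists>\<tau>::nat \<Rightarrow> real \<Rightarrow> complex. (\<forall>N. trig_sum (\<tau> N)) \<and>
        (\<lambda>N. Limsup at_top
           (\<lambda>T::real. ereal (1 / (2 * T) * (LINT x:{-T..T}|lebesgue. cmod (f x - \<tau> N x)))))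
        \<longlonglongrightarrow> 0)"

text \<open>Only meaningful when the limit exists, as it does for Besicovitch almost periodic functions.\<close>

definition mean_value :: "(real \<Rightarrow> complex) \<Rightarrow> complex" where
  "mean_value f = Lim at_top (\<lambda>T::real. (1 / of_real T) * (LINT x:{0..T}|lebesgue. f x))"

definition fourier_coeff :: "(real \<Rightarrow> complex) \<Rightarrow> real \<Rightarrow> complex" where
  "fourier_coeff f l = mean_value (\<lambda>x. f x * exp (- \<i> * of_real (l * x)))"

definition fourier_exponents :: "(real \<Rightarrow> complex) \<Rightarrow> real set" where
  "fourier_exponents f = {l. fourier_coeff f l \<noteq> 0}"

definition exponent_sequence :: "(int \<Rightarrow> real) \<Rightarrow> bool" where
  "exponent_sequence lam \<longleftrightarrow> lam 0 = 0 \<and> (\<forall>k. lam (- k) = - lam k) \<and>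
     (\<forall>k\<ge>1. 0 < lam k \<and> lam k < lam (k + 1)) \<and> filterlim lam at_top at_top"

definition B_ap_spec :: "(int \<Rightarrow> real) \<Rightarrow> (real \<Rightarrow> complex) set" where
  "B_ap_spec lam = {f. B_ap f \<and> fourier_exponents f \<subseteq> range lam}"

text \<open>The form (F): all frequencies \<open>lam k\<close> with \<open>k \<ge> 1\<close> are present, up to sign; the
  constant term may vanish.\<close>

definition full_fourier_series :: "(int \<Rightarrow> real) \<Rightarrow> (real \<Rightarrow> complex) \<Rightarrow> bool" where
  "full_fourier_series lam f \<longleftrightarrow>
     (\<forall>k\<ge>1. cmod (fourier_coeff f (lam k)) + cmod (fourier_coeff f (lam (- k))) > 0)"


section \<open>The Besicovitch--Musielak--Orlicz space\<close>

definition orlicz_function :: "(real \<Rightarrow> real) \<Rightarrow> bool" where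
  "orlicz_function M \<longleftrightarrow> (\<forall>t\<ge>0. 0 \<le> M t) \<and> mono_on {0..} M \<and> convex_on {0..} M \<and>
     M 0 = 0 \<and> filterlim M at_top at_top"

text \<open>The conjugate may be infinite. Negative values of \<open>u * v - M u\<close> are truncated to \<open>0\<close>, which
  does not affect the supremum, since \<open>M 0 = 0\<close>.\<close>

definition conjugate :: "(real \<Rightarrow> real) \<Rightarrow> real \<Rightarrow> ennreal" where
  "conjugate M v = (SUP u\<in>{0..}. ennreal (u * v - M u))"

definition weights :: "(int \<Rightarrow> real \<Rightarrow> real) \<Rightarrow> (int \<Rightarrow> real) set" where
  "weights M = {\<gamma>. (\<forall>k. 0 < \<gamma> k) \<and> (\<Sum>\<^sub>\<infinity>k. conjugate (M k) (\<gamma> k)) \<le> 1}"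

definition norm_M ::
  "(int \<Rightarrow> real) \<Rightarrow> (int \<Rightarrow> real \<Rightarrow> real) \<Rightarrow> (real \<Rightarrow> complex) \<Rightarrow> ennreal" where
  "norm_M lam M f =
     (SUP \<gamma>\<in>weights M. \<Sum>\<^sub>\<infinity>k. ennreal (\<gamma> k * cmod (fourier_coeff f (lam k))))"

text \<open>Functions with the same Fourier series are not identified explicitly: everything below
  depends on a function only through its Fourier coefficients.\<close>

definition BS_space ::
  "(int \<Rightarrow> real) \<Rightarrow> (int \<Rightarrow> real \<Rightarrow> real) \<Rightarrow> (real \<Rightarrow> complex) set" where
  "BS_space lam M = {f \<in> B_ap_spec lam. norm_M lam M f < \<infinity>}"

definition best_approx ::
  "(int \<Rightarrow> real) \<Rightarrow> (int \<Rightarrow> real \<Rightarrow> real) \<Rightarrow> nat \<Rightarrow> (real \<Rightarrow> complex) \<Rightarrow> ennreal" where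
  "best_approx lam M n f =
     (INF g\<in>{g \<in> B_ap_spec lam. fourier_exponents g \<subseteq> {- lam (int n)<..<lam (int n)}}.
        norm_M lam M (\<lambda>x. f x - g x))"

definition smooth_phi :: "real \<Rightarrow> real \<Rightarrow> real" where
  "smooth_phi \<alpha> t = 2 powr (\<alpha> / 2) * (1 - cos t) powr (\<alpha> / 2)"

definition modulus_smoothness ::
  "(int \<Rightarrow> real) \<Rightarrow> (int \<Rightarrow> real \<Rightarrow> real) \<Rightarrow> real \<Rightarrow> (real \<Rightarrow> complex) \<Rightarrow> real \<Rightarrow> ennreal" where
  "modulus_smoothness lam M \<alpha> f \<delta> =
     (SUP h\<in>{h. \<bar>h\<bar> \<le> \<delta>}. SUP \<gamma>\<in>weights M.
        \<Sum>\<^sub>\<infinity>k. ennreal (\<gamma> k * smooth_phi \<alpha> (lam k * h) * cmod (fourier_coeff f (lam k))))"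

definition I_const :: "(int \<Rightarrow> real) \<Rightarrow> nat \<Rightarrow> real \<Rightarrow> real" where
  "I_const lam n \<beta> =
     (INF k\<in>{n..}. LBINT u:{0..pi}. (1 - cos (lam (int k) * u / lam (int n))) powr \<beta> * sin u)"

definition modulus_integral ::
  "(int \<Rightarrow> real) \<Rightarrow> (int \<Rightarrow> real \<Rightarrow> real) \<Rightarrow> real \<Rightarrow> nat \<Rightarrow> (real \<Rightarrow> complex) \<Rightarrow> ennreal" where
  "modulus_integral lam M \<alpha> n f =
     (\<integral>\<^sup>+u\<in>{0..pi}. modulus_smoothness lam M \<alpha> f (u / lam (int n)) * ennreal (sin u) \<partial>lborel)"

end

theory Submission
  imports Defs
begin

text \<open>
  Every quantity in the theorem depends on \<open>f\<close> only through the moduli of its Fourier coefficients,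
  so for a fixed weight sequence \<open>\<gamma>\<close> everything reduces to numerical series.

  The inequality. Subtracting from \<open>f\<close> the part of its Fourier series with \<open>\<bar>k\<bar> < n\<close> leaves the
  coefficients with \<open>\<bar>k\<bar> \<ge> n\<close>. For each of these, averaging the factor
  \<open>smooth_phi \<alpha> (lam k * u / lam n)\<close> of the modulus of smoothness against \<open>sin u\<close> over
  \<open>[0, pi]\<close> gives at least \<open>2 powr (\<alpha> / 2)\<close> times \<open>I_const\<close>, by the definition of \<open>I_const\<close> as an
  infimum. Hence \<open>I_const\<close> times each partial sum of the norm of the remainder is bounded by the
  integral of the modulus (\<open>direct_inequality\<close>). Dividing by \<open>I_const\<close> requires that the infimum
  is not zero.

  The value of \<open>I_const\<close>. For a natural exponent \<open>m\<close>, two integrations by parts relate the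
  integrals \<open>J m\<close> of \<open>(1 - cos (a * u)) ^ m * sin u\<close> over \<open>[0, pi]\<close> by
  \<open>(a\<^sup>2 * m\<^sup>2 - 1) * J m = a\<^sup>2 * m * (2 * m - 1) * J (m - 1) - (1 - cos (a * pi)) ^ m\<close>
  (\<open>cos_moment_Suc\<close>). Estimating the last term by \<open>2 ^ m\<close>, induction on \<open>m\<close> gives
  \<open>J m \<ge> 2 ^ (m + 1) / (m + 1)\<close> for all \<open>a \<ge> 1\<close> (\<open>cos_moment_lower_bound\<close>), with equality for
  \<open>a = 1\<close>. As \<open>a = lam k / lam n\<close> equals 1 for \<open>k = n\<close>, this is the infimum. For an arbitrary
  exponent \<open>\<beta> > 0\<close>, the comparison \<open>(x / 2) powr \<beta> \<ge> (x / 2) ^ m\<close> with a natural \<open>m \<ge> \<beta>\<close>, valid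
  for \<open>0 \<le> x \<le> 2\<close>, shows that the infimum is positive.

  Sharpness. For the single exponential with frequency \<open>lam n\<close> the inequality is an equality when
  the infimum is attained at \<open>k = n\<close>. This function lacks the other frequencies, so a series with
  positive but arbitrarily small coefficients at all \<open>lam k\<close> with \<open>k \<ge> 1\<close> is added. The best
  approximation does not drop below the contribution of \<open>lam n\<close>, while the integral of the modulus
  changes by an arbitrarily small amount (\<open>constant_lower_bound\<close>).

  Both parts compute Fourier coefficients of differences, so the mean values of Besicovitch almost
  periodic functions must be shown to exist: the means of trigonometric sums converge, and those of
  \<open>f\<close> stay close to them (\<open>mean_value_limit\<close>).
\<close>

section \<open>Integrals of powers of \<open>1 - cos\<close> against the sine\<close>

definition cos_moment :: "nat \<Rightarrow> real \<Rightarrow> real" where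
  "cos_moment m a = integral {0..pi} (\<lambda>u. (1 - cos (a * u)) ^ m * sin u)"

lemma cos_moment_has_integral:
  "((\<lambda>u. (1 - cos (a * u)) ^ m * sin u) has_integral cos_moment m a) {0..pi}"
  unfolding cos_moment_def
  by (intro integrable_integral integrable_continuous_real continuous_intros)

lemma cos_moment_0: "cos_moment 0 a = 2"
proof -
  have "(sin has_integral (- cos pi - (- cos 0))) {0..pi}"
    by (rule fundamental_theorem_of_calculus)
       (auto intro!: derivative_eq_intros simp flip: has_real_derivative_iff_has_vector_derivative)
  then show ?thesis
    using has_integral_unique[OF cos_moment_has_integral[where m = 0]] by simp
qed

text \<open>
  With \<open>s u = 1 - cos (a * u)\<close> one has \<open>s'\<^sup>2 = a\<^sup>2 * s * (2 - s)\<close> and \<open>s'' = a\<^sup>2 * (1 - s)\<close>, so the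
  second derivative of \<open>s ^ m\<close> is a combination of \<open>s ^ (m - 1)\<close> and \<open>s ^ m\<close>. Integrating
  \<open>s ^ m * sin u\<close> by parts twice therefore closes up into a two-term recurrence. Below, \<open>G\<close> is the
  sum of the two boundary terms, and the recurrence is the fundamental theorem of calculus for \<open>G\<close>.
\<close>

lemma cos_moment_Suc:
  "(a\<^sup>2 * real (Suc k) ^ 2 - 1) * cos_moment (Suc k) a
     = a\<^sup>2 * real (Suc k) * (2 * real k + 1) * cos_moment k a - (1 - cos (a * pi)) ^ Suc k"
proof -
  define s where "s = (\<lambda>u. 1 - cos (a * u))"
  define G where "G = (\<lambda>u. real (Suc k) * a * s u ^ k * sin (a * u) * sin u - s u ^ Suc k * cos u)"
  define g where "g = (\<lambda>u. (1 - a\<^sup>2 * real (Suc k) ^ 2) * (s u ^ Suc k * sin u)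
                          + a\<^sup>2 * real (Suc k) * (2 * real k + 1) * (s u ^ k * sin u))"
  have D: "(G has_real_derivative g u) (at u within {0..pi})" for u
  proof -
    have s': "(s has_real_derivative a * sin (a * u)) (at u within {0..pi})"
      unfolding s_def by (auto intro!: derivative_eq_intros)
    have sin2: "sin (a * u) * sin (a * u) = s u * (2 - s u)"
      unfolding s_def using sin_cos_squared_add[of "a * u"] by (simp add: algebra_simps power2_eq_square)
    \<comment> \<open>The exponent \<open>k - Suc 0\<close> is truncated only for \<open>k = 0\<close>, where the factor \<open>k\<close> vanishes.\<close>
    have step: "real k * s u ^ (k - Suc 0) * (sin (a * u) * sin (a * u)) = real k * s u ^ k * (2 - s u)"
      unfolding sin2 by (cases k) simp_all
    have "(G has_real_derivative
        (real (Suc k) * a * (real k * s u ^ (k - Suc 0) * (a * sin (a * u))) * sin (a * u) * sin u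
         + real (Suc k) * a * s u ^ k * (a * cos (a * u)) * sin u
         + s u ^ Suc k * sin u)) (at u within {0..pi})"
    proof -
      define P Q where "P = (\<lambda>u. s u ^ k)" and "Q = (\<lambda>u. s u ^ Suc k)"
      have dP: "(P has_real_derivative real k * s u ^ (k - Suc 0) * (a * sin (a * u))) (at u within {0..pi})"
        unfolding P_def using DERIV_power[OF s', of k] by (simp add: mult_ac)
      have dQ: "(Q has_real_derivative real (Suc k) * (s u ^ k * (a * sin (a * u)))) (at u within {0..pi})"
        unfolding Q_def using DERIV_power_Suc[OF s', of k] by (simp add: mult_ac)
      have G: "G = (\<lambda>u. real (Suc k) * a * P u * sin (a * u) * sin u - Q u * cos u)"
        by (simp add: G_def P_def Q_def)
      show ?thesis
        unfolding G by (rule DERIV_cong, (rule derivative_intros dP dQ)+) (simp add: P_def Q_def algebra_simps)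
    qed
    also have "real (Suc k) * a * (real k * s u ^ (k - Suc 0) * (a * sin (a * u))) * sin (a * u) * sin u
        = real (Suc k) * a\<^sup>2 * (real k * s u ^ (k - Suc 0) * (sin (a * u) * sin (a * u))) * sin u"
      by (simp add: power2_eq_square algebra_simps)
    also have "cos (a * u) = 1 - s u" by (simp add: s_def)
    also have "real (Suc k) * a\<^sup>2 * (real k * s u ^ (k - Suc 0) * (sin (a * u) * sin (a * u))) * sin u
         + real (Suc k) * a * s u ^ k * (a * (1 - s u)) * sin u + s u ^ Suc k * sin u = g u"
      unfolding step g_def by (simp add: power2_eq_square algebra_simps)
    finally show ?thesis .
  qed
  have "(g has_integral (G pi - G 0)) {0..pi}"
    by (rule fundamental_theorem_of_calculus)
       (auto intro!: D simp flip: has_real_derivative_iff_has_vector_derivative)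
  moreover have "(g has_integral
      ((1 - a\<^sup>2 * real (Suc k) ^ 2) * cos_moment (Suc k) a
        + a\<^sup>2 * real (Suc k) * (2 * real k + 1) * cos_moment k a)) {0..pi}"
    unfolding g_def s_def
    by (intro has_integral_add has_integral_mult_right cos_moment_has_integral)
  ultimately have "(1 - a\<^sup>2 * real (Suc k) ^ 2) * cos_moment (Suc k) a
        + a\<^sup>2 * real (Suc k) * (2 * real k + 1) * cos_moment k a = G pi - G 0"
    by (rule has_integral_unique [symmetric])
  moreover have "G pi - G 0 = (1 - cos (a * pi)) ^ Suc k"
    by (simp add: G_def s_def)
  ultimately show ?thesis
    by (simp only: left_diff_distrib)
qed

lemma cos_moment_1: "cos_moment m 1 = 2 ^ (m + 1) / (real m + 1)"
proof -
  have "((\<lambda>u. (1 - cos u) ^ Suc m / real (Suc m)) has_real_derivative (1 - cos u) ^ m * sin u)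
      (at u within {0..pi})" for u
  proof -
    have "((\<lambda>u. 1 - cos u) has_real_derivative sin u) (at u within {0..pi})"
      by (auto intro!: derivative_eq_intros)
    from DERIV_cdivide[OF DERIV_power_Suc[OF this, of m], of "real (Suc m)"] show ?thesis
      by (simp add: divide_simps mult_ac)
  qed
  then have "((\<lambda>u. (1 - cos u) ^ m * sin u) has_integral
      ((1 - cos pi) ^ Suc m / real (Suc m) - (1 - cos 0) ^ Suc m / real (Suc m))) {0..pi}"
    by (intro fundamental_theorem_of_calculus)
       (auto simp flip: has_real_derivative_iff_has_vector_derivative)
  then show ?thesis
    using has_integral_unique[OF cos_moment_has_integral[of 1 m]] by (simp add: algebra_simps)
qed

text \<open>
  For \<open>a = 1\<close> the factor \<open>a\<^sup>2 * m\<^sup>2 - 1\<close> of the recurrence vanishes at \<open>m = 1\<close>, but there the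
  integral is elementary. For \<open>a > 1\<close>, insert the induction hypothesis and the bound
  \<open>(1 - cos (a * pi)) ^ m \<le> 2 ^ m\<close> into the recurrence: the bound for \<open>m\<close> follows because
  \<open>(m + 1) * (a\<^sup>2 * (2 * m - 1) - 1) - 2 * (a\<^sup>2 * m\<^sup>2 - 1) = (a\<^sup>2 - 1) * (m - 1) \<ge> 0\<close>.
\<close>

lemma cos_moment_lower_bound:
  assumes "a \<ge> 1"
  shows "cos_moment m a \<ge> 2 ^ (m + 1) / (real m + 1)"
proof (cases "a = 1")
  case True
  then show ?thesis using cos_moment_1[of m] by simp
next
  case False
  then have "a > 1" using assms by simp
  show ?thesis
  proof (induction m)
    case 0
    show ?case by (simp add: cos_moment_0)
  next
    case (Suc k)
    define m where "m = real k + 1"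
    have m: "m \<ge> 1" "real (Suc k) = m" "2 * real k + 1 = 2 * m - 1" by (auto simp: m_def)
    have a2: "a\<^sup>2 > 1" using \<open>a > 1\<close> by (simp add: one_less_power)
    have m2: "m\<^sup>2 \<ge> 1" using m(1) by (simp add: one_le_power)
    have den: "a\<^sup>2 * m\<^sup>2 - 1 > 0"
      using mult_le_cancel_left_pos[of "a\<^sup>2" 1 "m\<^sup>2"] a2 m2 by linarith
    have "(1 - cos (a * pi)) ^ Suc k \<le> 2 ^ Suc k"
      using cos_ge_minus_one[of "a * pi"] by (intro power_mono) simp_all
    moreover have "a\<^sup>2 * m * (2 * m - 1) * cos_moment k a \<ge> a\<^sup>2 * m * (2 * m - 1) * (2 ^ Suc k / m)"
      using Suc m a2 by (intro mult_left_mono) (auto simp: m_def)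
    ultimately have "(a\<^sup>2 * m\<^sup>2 - 1) * cos_moment (Suc k) a \<ge> a\<^sup>2 * (2 * m - 1) * 2 ^ Suc k - 2 ^ Suc k"
      using cos_moment_Suc[of a k] m by (simp only: m(2,3)) (simp add: mult.assoc)
    then have 1: "(m + 1) * ((a\<^sup>2 * m\<^sup>2 - 1) * cos_moment (Suc k) a)
        \<ge> (m + 1) * (a\<^sup>2 * (2 * m - 1) * 2 ^ Suc k - 2 ^ Suc k)"
      using m by (intro mult_left_mono) auto
    have "(m + 1) * (a\<^sup>2 * (2 * m - 1) * 2 ^ Suc k - 2 ^ Suc k) - (a\<^sup>2 * m\<^sup>2 - 1) * 2 ^ (Suc k + 1)
        = 2 ^ Suc k * ((a\<^sup>2 - 1) * (m - 1))"
      by (simp add: algebra_simps power2_eq_square)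
    moreover have "2 ^ Suc k * ((a\<^sup>2 - 1) * (m - 1)) \<ge> 0"
      using a2 m by simp
    ultimately have "(a\<^sup>2 * m\<^sup>2 - 1) * 2 ^ (Suc k + 1) \<le> (a\<^sup>2 * m\<^sup>2 - 1) * ((m + 1) * cos_moment (Suc k) a)"
      using 1 by (simp only: mult.left_commute)
    then have "2 ^ (Suc k + 1) \<le> (m + 1) * cos_moment (Suc k) a"
      using den by (simp only: mult_le_cancel_left_pos)
    then show ?case
      unfolding m(2) using m(1) by (simp add: pos_divide_le_eq mult.commute)
  qed
qed

definition cos_powr_integral :: "real \<Rightarrow> real \<Rightarrow> real" where
  "cos_powr_integral \<beta> a = (LBINT u:{0..pi}. (1 - cos (a * u)) powr \<beta> * sin u)"

lemma cos_powr_set_integrable: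
  assumes "\<beta> > 0"
  shows "set_integrable lborel {0..pi} (\<lambda>u. (1 - cos (a * u)) powr \<beta> * sin u)"
proof -
  have "continuous_on {0..pi} (\<lambda>u. (1 - cos (a * u)) powr \<beta>)"
    using assms by (intro continuous_on_powr' ballI continuous_intros) auto
  then have "continuous_on {0..pi} (\<lambda>u. (1 - cos (a * u)) powr \<beta> * sin u)"
    by (rule continuous_on_mult) (rule continuous_on_sin[OF continuous_on_id])
  then show ?thesis
    unfolding set_integrable_def by (rule borel_integrable_compact[OF compact_Icc])
qed

lemma cos_powr_integral_of_nat:
  assumes "m \<ge> 1"
  shows "cos_powr_integral (real m) a = cos_moment m a"
proof -
  have "cos_powr_integral (real m) a = integral {0..pi} (\<lambda>u. (1 - cos (a * u)) powr real m * sin u)"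
    unfolding cos_powr_integral_def
    using assms by (intro set_borel_integral_eq_integral cos_powr_set_integrable) simp
  also have "\<dots> = cos_moment m a"
    unfolding cos_moment_def using assms by (simp add: powr_realpow')
  finally show ?thesis .
qed

text \<open>
  The base \<open>1 - cos (a * u)\<close> lies between 0 and 2. Dividing it by 2 makes raising the exponent from
  \<open>\<beta>\<close> to \<open>m\<close> decrease the power, which reduces the claim to the natural exponent \<open>m\<close>. The bound does
  not depend on \<open>a\<close>, so it survives the infimum over \<open>k\<close>.
\<close>

lemma cos_powr_integral_lower_bound:
  assumes "0 < \<beta>" "\<beta> \<le> real m" "1 \<le> a"
  shows "cos_powr_integral \<beta> a \<ge> 2 powr \<beta> * 2 / (real m + 1)"
proof -
  have m: "m \<ge> 1" using assms by linarith
  have scale: "x powr \<beta> \<ge> (2 powr \<beta> / 2 ^ m) * x powr real m" if "0 \<le> x" "x \<le> 2" for x :: real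
  proof -
    have "(x / 2) powr real m \<le> (x / 2) powr \<beta>"
      using assms that by (intro powr_mono') auto
    then show ?thesis
      using that by (simp add: powr_divide powr_realpow field_simps)
  qed
  have "2 powr \<beta> * 2 / (real m + 1) = (2 powr \<beta> / 2 ^ m) * (2 ^ (m + 1) / (real m + 1))"
    by simp
  also have "\<dots> \<le> (2 powr \<beta> / 2 ^ m) * cos_powr_integral (real m) a"
    unfolding cos_powr_integral_of_nat[OF m]
    using cos_moment_lower_bound[OF \<open>1 \<le> a\<close>] by (intro mult_left_mono) auto
  also have "\<dots> = (LBINT u:{0..pi}. (2 powr \<beta> / 2 ^ m) * ((1 - cos (a * u)) powr real m * sin u))"
    unfolding cos_powr_integral_def by (rule set_integral_mult_right [symmetric])
  also have "\<dots> \<le> cos_powr_integral \<beta> a"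
    unfolding cos_powr_integral_def
  proof (rule set_integral_mono)
    fix u :: real assume u: "u \<in> {0..pi}"
    have "(2 powr \<beta> / 2 ^ m) * (1 - cos (a * u)) powr real m \<le> (1 - cos (a * u)) powr \<beta>"
      using cos_ge_minus_one[of "a * u"] by (intro scale) simp_all
    then show "(2 powr \<beta> / 2 ^ m) * ((1 - cos (a * u)) powr real m * sin u) \<le> (1 - cos (a * u)) powr \<beta> * sin u"
      using u sin_ge_zero[of u] by (subst mult.assoc [symmetric]) (intro mult_right_mono; simp)
  qed (use assms m in \<open>auto intro!: cos_powr_set_integrable set_integrable_mult_right\<close>)
  finally show ?thesis .
qed

section \<open>Exponent sequences and the constant \<open>I_const\<close>\<close>

lemma exponent_sequence_strict_mono:
  assumes "exponent_sequence lam"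
  shows "strict_mono lam"
proof (rule strict_monoI)
  have odd: "lam (- k) = - lam k" and pos: "k \<ge> 1 \<Longrightarrow> 0 < lam k \<and> lam k < lam (k + 1)"
    and zero: "lam 0 = 0" for k
    using assms unfolding exponent_sequence_def by blast+
  have step: "lam k < lam (k + 1)" for k
  proof -
    consider "k \<ge> 1" | "k = 0" | "k = -1" | "- k - 1 \<ge> 1" by linarith
    then show ?thesis
    proof cases
      case 4
      then show ?thesis using pos[of "- k - 1"] odd[of "- k - 1"] odd[of "-k"] by (simp add: add.commute)
    qed (use pos[of k] pos[of 1] odd[of 1] zero in auto)
  qed
  fix k l :: int assume "k < l"
  then show "lam k < lam l"
    by (induction l rule: int_gr_induct) (use step in \<open>auto intro: less_trans\<close>)
qed

context
  fixes lam :: "int \<Rightarrow> real" and n :: nat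
  assumes lam: "exponent_sequence lam" and n: "n \<ge> 1"
begin

lemma lam_pos: "lam (int n) > 0"
  using lam n by (simp add: exponent_sequence_def)

lemma lam_ratio_ge_1: "k \<ge> n \<Longrightarrow> lam (int k) / lam (int n) \<ge> 1"
  using lam_pos strict_mono_less_eq[OF exponent_sequence_strict_mono[OF lam], of "int n" "int k"] by simp

lemma I_const_alt: "I_const lam n \<beta> = (INF k\<in>{n..}. cos_powr_integral \<beta> (lam (int k) / lam (int n)))"
  by (simp add: I_const_def cos_powr_integral_def)

lemma I_const_lower_bound:
  assumes "0 < \<beta>" "\<beta> \<le> real m"
  shows "I_const lam n \<beta> \<ge> 2 powr \<beta> * 2 / (real m + 1)"
  unfolding I_const_alt
  using assms lam_ratio_ge_1 by (intro cINF_greatest cos_powr_integral_lower_bound) auto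

lemma I_const_pos: "0 < \<beta> \<Longrightarrow> I_const lam n \<beta> > 0"
  using I_const_lower_bound[of \<beta> "nat \<lceil>\<beta>\<rceil>"] 
  by (smt (verit) of_nat_0_le_iff divide_pos_pos mult_pos_pos powr_gt_zero real_nat_ceiling_ge)

lemma I_const_le:
  assumes "0 < \<beta>" "k \<ge> n"
  shows "I_const lam n \<beta> \<le> cos_powr_integral \<beta> (lam (int k) / lam (int n))"
  unfolding I_const_alt
proof (rule cINF_lower)
  obtain m where "\<beta> \<le> real m" using real_arch_simple by blast
  then show "bdd_below ((\<lambda>k. cos_powr_integral \<beta> (lam (int k) / lam (int n))) ` {n..})"
    using assms lam_ratio_ge_1
    by (intro bdd_belowI2[where m = "2 powr \<beta> * 2 / (real m + 1)"] cos_powr_integral_lower_bound) auto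
qed (use assms in simp)

lemma I_const_of_nat:
  assumes "m \<ge> 1"
  shows "I_const lam n (real m) = 2 powr (real m + 1) / (real m + 1)"
proof (rule antisym)
  have "I_const lam n (real m) \<le> cos_powr_integral (real m) (lam (int n) / lam (int n))"
    using assms by (intro I_const_le) auto
  then show "I_const lam n (real m) \<le> 2 powr (real m + 1) / (real m + 1)"
    using lam_pos assms cos_moment_1[of m] by (simp add: cos_powr_integral_of_nat powr_add powr_realpow mult.commute)
  show "2 powr (real m + 1) / (real m + 1) \<le> I_const lam n (real m)"
    using I_const_lower_bound[of "real m" m] assms by (simp add: powr_add)
qed

end

section \<open>Fourier coefficients of almost periodic functions\<close>

definition mean_upto :: "(real \<Rightarrow> complex) \<Rightarrow> real \<Rightarrow> complex" where
  "mean_upto f T = (1 / of_real T) * (LINT x:{0..T}|lebesgue. f x)"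

text \<open>
  The Besicovitch seminorm of \<open>f - g\<close>.
\<close>

definition mean_dist :: "(real \<Rightarrow> complex) \<Rightarrow> (real \<Rightarrow> complex) \<Rightarrow> ereal" where
  "mean_dist f g = Limsup at_top
     (\<lambda>T::real. ereal (1 / (2 * T) * (LINT x:{-T..T}|lebesgue. cmod (f x - g x))))"

definition locally_integrable :: "(real \<Rightarrow> complex) \<Rightarrow> bool" where
  "locally_integrable f \<longleftrightarrow> (\<forall>a b. f absolutely_integrable_on {a..b})"

lemma B_ap_alt:
  "B_ap f \<longleftrightarrow> locally_integrable f \<and>
     (\<exists>\<tau>. (\<forall>N. trig_sum (\<tau> N)) \<and> (\<lambda>N. mean_dist f (\<tau> N)) \<longlonglongrightarrow> 0)"
  by (simp add: B_ap_def mean_dist_def locally_integrable_def)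

lemma continuous_imp_locally_integrable:
  "continuous_on UNIV f \<Longrightarrow> locally_integrable f"
  unfolding locally_integrable_def
  by (blast intro: absolutely_integrable_continuous_real continuous_on_subset)

text \<open>
  Fourier coefficients of \<open>f\<close> are mean values of \<open>f\<close> times a character; since characters are
  bounded and continuous, facts about mean values of locally integrable functions transfer to them.
\<close>

lemma locally_integrable_mult_cis:
  assumes "locally_integrable f"
  shows "locally_integrable (\<lambda>x. f x * exp (- \<i> * of_real (l * x)))"
  unfolding locally_integrable_def
proof (intro allI)
  fix a b :: real
  let ?e = "\<lambda>x. exp (- \<i> * of_real (l * x)) :: complex"
  have e: "continuous_on {a..b} ?e"
    by (intro continuous_intros)
  have "bounded (?e ` {a..b})"
    by (intro compact_imp_bounded compact_continuous_image e) simp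
  moreover have "?e \<in> borel_measurable (lebesgue_on {a..b})"
    by (intro continuous_imp_measurable_on_sets_lebesgue e) simp
  moreover have "bilinear (\<lambda>x y::complex. y * x)"
    by (simp add: bilinear_conv_bounded_bilinear bounded_bilinear.flip bounded_bilinear_mult)
  ultimately show "(\<lambda>x. f x * ?e x) absolutely_integrable_on {a..b}"
    using absolutely_integrable_bounded_measurable_product[of "\<lambda>x y. y * x" ?e "{a..b}" f] assms
    by (simp add: locally_integrable_def)
qed

text \<open>
  The seminorm averages over \<open>[-T, T]\<close> and the mean value over \<open>[0, T]\<close>; halving the length of the
  interval costs the factor 2.
\<close>

lemma mean_upto_diff_le:
  assumes f: "locally_integrable f" and g: "locally_integrable g" and T: "T > 0"
  shows "cmod (mean_upto f T - mean_upto g T)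
           \<le> 2 * (1 / (2 * T) * (LINT x:{-T..T}|lebesgue. cmod (f x - g x)))"
proof -
  have int: "(\<lambda>x. f x - g x) absolutely_integrable_on {a..b}" for a b
    using f g by (auto simp: locally_integrable_def intro: set_integral_diff)
  have nint: "set_integrable lebesgue {a..b} (\<lambda>x. cmod (f x - g x))" for a b
    using int by (rule set_integrable_norm)
  have "mean_upto f T - mean_upto g T = (1 / of_real T) * (LINT x:{0..T}|lebesgue. f x - g x)"
    unfolding mean_upto_def using f g
    by (simp add: locally_integrable_def set_integral_diff right_diff_distrib)
  then have "cmod (mean_upto f T - mean_upto g T) = (1 / T) * cmod (LINT x:{0..T}|lebesgue. f x - g x)"
    using T by (simp add: norm_mult norm_divide)
  also have "\<dots> \<le> (1 / T) * (LINT x:{0..T}|lebesgue. cmod (f x - g x))"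
    using T int by (intro mult_left_mono set_integral_norm_bound) auto
  also have "\<dots> \<le> (1 / T) * (LINT x:{-T..T}|lebesgue. cmod (f x - g x))"
  proof (intro mult_left_mono)
    show "(LINT x:{0..T}|lebesgue. cmod (f x - g x)) \<le> (LINT x:{-T..T}|lebesgue. cmod (f x - g x))"
      unfolding set_lebesgue_integral_def
    proof (rule integral_mono)
      show "integrable lebesgue (\<lambda>x. indicator {0..T} x *\<^sub>R cmod (f x - g x))"
           "integrable lebesgue (\<lambda>x. indicator {-T..T} x *\<^sub>R cmod (f x - g x))"
        using nint unfolding set_integrable_def by blast+
    qed (use T in \<open>auto simp: indicator_def\<close>)
  qed (use T in auto)
  finally show ?thesis using T by simp
qed

lemma eventually_mean_upto_close:
  assumes "locally_integrable f" "locally_integrable g" "mean_dist f g < ereal e"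
  shows "\<forall>\<^sub>F T in at_top. cmod (mean_upto f T - mean_upto g T) < 2 * e"
proof -
  have "\<forall>\<^sub>F T in at_top. ereal (1 / (2 * T) * (LINT x:{-T..T}|lebesgue. cmod (f x - g x))) < ereal e"
    using assms(3) unfolding mean_dist_def by (rule Limsup_lessD)
  then show ?thesis
    using eventually_gt_at_top[of 0]
    by eventually_elim (use mean_upto_diff_le[OF assms(1,2)] in fastforce)
qed

text \<open>
  A three epsilon argument. Eventually the averages of \<open>f\<close> differ little from those of \<open>\<tau> N\<close>, hence
  from \<open>L N\<close>. Comparing two indices at a common large \<open>T\<close> shows that \<open>L\<close> is a Cauchy sequence, and
  its limit is then also the limit of the averages of \<open>f\<close>. So the mean value is a genuine limit and
  is computed from any approximating sequence.
\<close>

lemma mean_value_limit: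
  assumes f: "locally_integrable f" and \<tau>: "\<And>N. locally_integrable (\<tau> N)"
    and lim: "(\<lambda>N. mean_dist f (\<tau> N)) \<longlonglongrightarrow> 0"
    and L: "\<And>N. (mean_upto (\<tau> N) \<longlongrightarrow> L N) at_top"
  shows "(mean_upto f \<longlongrightarrow> mean_value f) at_top" and "L \<longlonglongrightarrow> mean_value f"
proof -
  have close: "\<forall>\<^sub>F N in sequentially. \<forall>\<^sub>F T in at_top. dist (mean_upto f T) (L N) < e"
    if "e > 0" for e
  proof -
    have "\<forall>\<^sub>F N in sequentially. mean_dist f (\<tau> N) < ereal (e / 4)"
      using that by (intro order_tendstoD[OF lim]) simp
    then show ?thesis
    proof eventually_elim
      case (elim N)
      have "\<forall>\<^sub>F T in at_top. dist (mean_upto (\<tau> N) T) (L N) < e / 2"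
        using that by (intro tendstoD[OF L]) simp
      with eventually_mean_upto_close[OF f \<tau> elim] show ?case
      proof eventually_elim
        case (elim T)
        then show ?case
          using dist_triangle[of "mean_upto f T" "L N" "mean_upto (\<tau> N) T"] by (simp add: dist_norm)
      qed
    qed
  qed
  have "Cauchy L"
  proof (rule metric_CauchyI)
    fix e :: real assume "e > 0"
    then obtain N0 where N0: "\<And>N. N \<ge> N0 \<Longrightarrow> \<forall>\<^sub>F T in at_top. dist (mean_upto f T) (L N) < e / 2"
      using close[of "e / 2"] unfolding eventually_sequentially by auto
    have "dist (L m) (L n) < e" if mn: "m \<ge> N0" "n \<ge> N0" for m n
    proof -
      obtain T where "dist (mean_upto f T) (L m) < e / 2" "dist (mean_upto f T) (L n) < e / 2"
        using eventually_happens[OF eventually_conj[OF N0[OF mn(1)] N0[OF mn(2)]]] by auto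
      then show ?thesis by (rule dist_triangle_half_r)
    qed
    then show "\<exists>M. \<forall>m\<ge>M. \<forall>n\<ge>M. dist (L m) (L n) < e" by blast
  qed
  then obtain l where l: "L \<longlonglongrightarrow> l"
    using Cauchy_convergent_iff convergent_def by blast
  have "(mean_upto f \<longlongrightarrow> l) at_top"
  proof (rule tendstoI)
    fix e :: real assume e: "e > 0"
    have "\<forall>\<^sub>F N in sequentially. dist (L N) l < e / 2 \<and> (\<forall>\<^sub>F T in at_top. dist (mean_upto f T) (L N) < e / 2)"
      using e by (intro eventually_conj tendstoD[OF l] close) auto
    then obtain N where N: "dist (L N) l < e / 2"
      and "\<forall>\<^sub>F T in at_top. dist (mean_upto f T) (L N) < e / 2"
      by (auto dest: eventually_happens)
    then show "\<forall>\<^sub>F T in at_top. dist (mean_upto f T) l < e"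
      by (elim eventually_mono) (metis N dist_triangle_half_l dist_commute)
  qed
  moreover from this have "mean_value f = l"
    unfolding mean_value_def mean_upto_def by (intro tendsto_Lim) auto
  ultimately show "(mean_upto f \<longlongrightarrow> mean_value f) at_top" and "L \<longlonglongrightarrow> mean_value f"
    using l by simp_all
qed

definition exp_sum :: "'a set \<Rightarrow> ('a \<Rightarrow> complex) \<Rightarrow> ('a \<Rightarrow> real) \<Rightarrow> real \<Rightarrow> complex" where
  "exp_sum I a \<mu> = (\<lambda>x. \<Sum>k\<in>I. a k * exp (\<i> * of_real (\<mu> k * x)))"

lemma trig_sum_alt: "trig_sum \<tau> \<longleftrightarrow> (\<exists>m::nat. \<exists>a \<mu>. \<tau> = exp_sum {..<m} a \<mu>)"
  by (simp add: trig_sum_def exp_sum_def)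

text \<open>
  Trigonometric sums are indexed by initial segments of the naturals; an enumeration of the index set
  allows arbitrary finite sets, in particular sets of integers.
\<close>

lemma trig_sum_exp_sum:
  assumes "finite I"
  shows "trig_sum (exp_sum I a \<mu>)"
proof -
  obtain h where h: "bij_betw h {..<card I} I"
    using ex_bij_betw_nat_finite[OF assms] by (auto simp: atLeast0LessThan)
  have "exp_sum I a \<mu> = exp_sum {..<card I} (a \<circ> h) (\<mu> \<circ> h)"
    by (simp add: exp_sum_def sum.reindex_bij_betw[OF h, symmetric] o_def)
  then show ?thesis unfolding trig_sum_alt by blast
qed

lemma locally_integrable_exp_sum: "locally_integrable (exp_sum I a \<mu>)"
  unfolding exp_sum_def by (intro continuous_imp_locally_integrable continuous_intros)

text \<open>
  Nontrivial characters have bounded primitives, so their averages decay like \<open>1 / T\<close>.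
\<close>

lemma mean_upto_cis:
  "(mean_upto (\<lambda>x. exp (\<i> * of_real (\<mu> * x))) \<longlongrightarrow> (if \<mu> = 0 then 1 else 0)) at_top"
proof (cases "\<mu> = 0")
  case True
  have "\<forall>\<^sub>F T in at_top. mean_upto (\<lambda>x. exp (\<i> * of_real (\<mu> * x))) T = 1"
    using eventually_gt_at_top[of 0]
    by eventually_elim (simp add: True mean_upto_def set_integral_const scaleR_conv_of_real)
  then show ?thesis using True by (simp add: tendsto_eventually)
next
  case False
  define F :: "real \<Rightarrow> complex" where "F = (\<lambda>x. exp (\<i> * of_real (\<mu> * x)) / (\<i> * of_real \<mu>))"
  have "\<forall>\<^sub>F T in at_top. cmod (mean_upto (\<lambda>x. exp (\<i> * of_real (\<mu> * x))) T) \<le> (2 / \<bar>\<mu>\<bar>) / T"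
    using eventually_gt_at_top[of 0]
  proof eventually_elim
    case (elim T)
    have "((\<lambda>x. exp (\<i> * of_real (\<mu> * x))) has_integral (F T - F 0)) {0..T}"
    proof (rule fundamental_theorem_of_calculus)
      fix x
      show "(F has_vector_derivative exp (\<i> * of_real (\<mu> * x))) (at x within {0..T})"
        unfolding F_def of_real_mult
      proof (rule has_vector_derivative_real_field)
        show "((\<lambda>z. exp (\<i> * (of_real \<mu> * z)) / (\<i> * of_real \<mu>))
            has_field_derivative exp (\<i> * (of_real \<mu> * of_real x))) (at (of_real x))"
          using False by (auto intro!: derivative_eq_intros simp: algebra_simps)
      qed
    qed (use elim in simp)
    moreover have "set_integrable lebesgue {0..T} (\<lambda>x. exp (\<i> * of_real (\<mu> * x)) :: complex)"
      by (intro absolutely_integrable_continuous_real continuous_intros)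
    ultimately have "(LINT x:{0..T}|lebesgue. exp (\<i> * of_real (\<mu> * x))) = F T - F 0"
      using set_lebesgue_integral_eq_integral(2) integral_unique by metis
    moreover have "cmod (F T - F 0) \<le> cmod (F T) + cmod (F 0)" 
      by (rule norm_triangle_ineq4)
    moreover have "cmod (F x) = 1 / \<bar>\<mu>\<bar>" for x
      by (simp add: F_def norm_divide norm_mult)
    ultimately have "cmod (LINT x:{0..T}|lebesgue. exp (\<i> * of_real (\<mu> * x))) \<le> 2 / \<bar>\<mu>\<bar>"
      by simp
    from divide_right_mono[OF this, of T] show ?case
      using elim unfolding mean_upto_def by (simp add: norm_mult norm_divide)
  qed
  moreover have "((\<lambda>T::real. (2 / \<bar>\<mu>\<bar>) / T) \<longlongrightarrow> 0) at_top"
    by (intro tendsto_divide_0[OF tendsto_const] filterlim_at_top_imp_at_infinity filterlim_ident)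
  ultimately show ?thesis using False by (simp add: Lim_null_comparison)
qed

lemma mean_upto_exp_sum:
  assumes "finite I"
  shows "(mean_upto (\<lambda>x. exp_sum I a \<mu> x * exp (- \<i> * of_real (l * x)))
            \<longlongrightarrow> (\<Sum>k\<in>I. if \<mu> k = l then a k else 0)) at_top"
proof -
  have shift: "exp_sum I a \<mu> x * exp (- \<i> * of_real (l * x))
      = (\<Sum>k\<in>I. a k * exp (\<i> * of_real ((\<mu> k - l) * x)))" for x
  proof -
    have "exp (\<i> * of_real (\<mu> k * x)) * exp (- \<i> * of_real (l * x))
        = (exp (\<i> * of_real ((\<mu> k - l) * x)) :: complex)" for k
      by (simp add: algebra_simps flip: exp_add)
    then show ?thesis
      by (simp only: exp_sum_def sum_distrib_right mult.assoc)
  qed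
  have mean: "mean_upto (\<lambda>x. exp_sum I a \<mu> x * exp (- \<i> * of_real (l * x)))
      = (\<lambda>T. \<Sum>k\<in>I. a k * mean_upto (\<lambda>x. exp (\<i> * of_real ((\<mu> k - l) * x))) T)"
  proof
    fix T
    have "set_integrable lebesgue {0..T} (\<lambda>x. a k * exp (\<i> * of_real ((\<mu> k - l) * x)))" for k
      by (intro absolutely_integrable_continuous_real continuous_intros)
    then have "(LINT x:{0..T}|lebesgue. \<Sum>k\<in>I. a k * exp (\<i> * of_real ((\<mu> k - l) * x)))
        = (\<Sum>k\<in>I. LINT x:{0..T}|lebesgue. a k * exp (\<i> * of_real ((\<mu> k - l) * x)))"
      unfolding set_lebesgue_integral_def set_integrable_def scaleR_sum_right
      by (rule Bochner_Integration.integral_sum)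
    then show "mean_upto (\<lambda>x. exp_sum I a \<mu> x * exp (- \<i> * of_real (l * x))) T
        = (\<Sum>k\<in>I. a k * mean_upto (\<lambda>x. exp (\<i> * of_real ((\<mu> k - l) * x))) T)"
      unfolding mean_upto_def shift by (simp add: sum_distrib_left mult.left_commute)
  qed
  have "((\<lambda>T. \<Sum>k\<in>I. a k * mean_upto (\<lambda>x. exp (\<i> * of_real ((\<mu> k - l) * x))) T)
      \<longlongrightarrow> (\<Sum>k\<in>I. a k * (if \<mu> k - l = 0 then 1 else 0))) at_top"
    by (intro tendsto_sum tendsto_mult tendsto_const mean_upto_cis)
  moreover have "(\<Sum>k\<in>I. a k * (if \<mu> k - l = 0 then 1 else 0)) = (\<Sum>k\<in>I. if \<mu> k = l then a k else 0)"
    by (rule sum.cong) auto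
  ultimately show ?thesis
    unfolding mean by (simp only:)
qed

text \<open>
  Multiplying by a character of modulus 1 leaves the seminorm unchanged, so the previous results on
  mean values apply to \<open>f\<close> times the character.
\<close>

lemma fourier_coeff_limit:
  assumes f: "locally_integrable f" and I: "\<And>N. finite (I N)"
    and lim: "(\<lambda>N. mean_dist f (exp_sum (I N) (a N) (\<mu> N))) \<longlonglongrightarrow> 0"
  shows "(mean_upto (\<lambda>x. f x * exp (- \<i> * of_real (l * x))) \<longlongrightarrow> fourier_coeff f l) at_top"
    and "(\<lambda>N. \<Sum>k\<in>I N. if \<mu> N k = l then a N k else 0) \<longlonglongrightarrow> fourier_coeff f l"
proof -
  let ?e = "\<lambda>x. exp (- \<i> * of_real (l * x)) :: complex"
  have "cmod (?e x) = 1" for x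
    by simp
  then have "mean_dist (\<lambda>x. f x * ?e x) (\<lambda>x. g x * ?e x) = mean_dist f g" for g
    unfolding mean_dist_def by (simp only: norm_mult mult_1_right flip: left_diff_distrib)
  then have lim': "(\<lambda>N. mean_dist (\<lambda>x. f x * ?e x) (\<lambda>x. exp_sum (I N) (a N) (\<mu> N) x * ?e x)) \<longlonglongrightarrow> 0"
    using lim by simp
  note * = mean_value_limit[OF locally_integrable_mult_cis[OF f]
      locally_integrable_mult_cis[OF locally_integrable_exp_sum] lim' mean_upto_exp_sum[OF I]]
  show "(mean_upto (\<lambda>x. f x * ?e x) \<longlongrightarrow> fourier_coeff f l) at_top"
    and "(\<lambda>N. \<Sum>k\<in>I N. if \<mu> N k = l then a N k else 0) \<longlonglongrightarrow> fourier_coeff f l"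
    unfolding fourier_coeff_def by (fact *)+
qed

lemma B_ap_mean_upto:
  assumes "B_ap f"
  shows "(mean_upto (\<lambda>x. f x * exp (- \<i> * of_real (l * x))) \<longlongrightarrow> fourier_coeff f l) at_top"
proof -
  obtain \<tau> where \<tau>: "\<And>N. trig_sum (\<tau> N)" "(\<lambda>N. mean_dist f (\<tau> N)) \<longlonglongrightarrow> 0" 
    and f: "locally_integrable f"
    using assms unfolding B_ap_alt by auto
  obtain m a \<mu> where "\<And>N. \<tau> N = exp_sum {..<m N::nat} (a N) (\<mu> N)"
    using \<tau>(1) unfolding trig_sum_alt by metis
  with \<tau>(2) show ?thesis
    using fourier_coeff_limit(1)[OF f, of "\<lambda>N. {..<m N}" a \<mu>] by simp
qed

lemma fourier_coeff_diff:
  assumes "B_ap f" "B_ap g"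
  shows "fourier_coeff (\<lambda>x. f x - g x) l = fourier_coeff f l - fourier_coeff g l"
proof -
  let ?e = "\<lambda>x. exp (- \<i> * of_real (l * x)) :: complex"
  have "locally_integrable f" "locally_integrable g"
    using assms by (auto simp: B_ap_alt)
  from this[THEN locally_integrable_mult_cis[of _ l]]
  have diff: "mean_upto (\<lambda>x. (f x - g x) * ?e x)
      = (\<lambda>T. mean_upto (\<lambda>x. f x * ?e x) T - mean_upto (\<lambda>x. g x * ?e x) T)"
    unfolding fun_eq_iff mean_upto_def locally_integrable_def left_diff_distrib
    by (auto simp: set_integral_diff right_diff_distrib)
  have "(mean_upto (\<lambda>x. (f x - g x) * ?e x) \<longlongrightarrow> fourier_coeff f l - fourier_coeff g l) at_top"
    unfolding diff by (intro tendsto_diff B_ap_mean_upto assms)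
  then show ?thesis
    unfolding fourier_coeff_def mean_value_def mean_upto_def by (intro tendsto_Lim) auto
qed

definition exp_series :: "(nat \<Rightarrow> complex) \<Rightarrow> (nat \<Rightarrow> real) \<Rightarrow> real \<Rightarrow> complex" where
  "exp_series a \<mu> = (\<lambda>x. \<Sum>k. a k * exp (\<i> * of_real (\<mu> k * x)))"

lemma mean_dist_le:
  assumes "\<And>x. cmod (f x - g x) \<le> e" "locally_integrable f" "locally_integrable g"
  shows "mean_dist f g \<le> ereal e"
  unfolding mean_dist_def
proof (rule Limsup_bounded)
  show "\<forall>\<^sub>F T in at_top. ereal (1 / (2 * T) * (LINT x:{-T..T}|lebesgue. cmod (f x - g x))) \<le> ereal e"
    using eventually_gt_at_top[of 0]
  proof eventually_elim
    case (elim T)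
    have "(\<lambda>x. f x - g x) absolutely_integrable_on {-T..T}"
      using assms(2,3) by (auto simp: locally_integrable_def intro: set_integral_diff)
    then have "(LINT x:{-T..T}|lebesgue. cmod (f x - g x)) \<le> (LINT x:{-T..T}|lebesgue. e)"
      using absolutely_integrable_continuous_real[OF continuous_on_const]
      by (intro set_integral_mono set_integrable_norm assms(1))
    also have "\<dots> = 2 * T * e"
      using elim by (simp add: set_integral_const)
    finally show ?case using elim by (simp add: field_simps)
  qed
qed

lemma mean_dist_nonneg: "mean_dist f g \<ge> 0"
  unfolding mean_dist_def
proof (rule le_Limsup)
  show "\<forall>\<^sub>F T in at_top. 0 \<le> ereal (1 / (2 * T) * (LINT x:{-T..T}|lebesgue. cmod (f x - g x)))"
    using eventually_gt_at_top[of 0]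
    by eventually_elim (auto simp: set_lebesgue_integral_def intro!: Bochner_Integration.integral_nonneg)
qed simp

context
  fixes a :: "nat \<Rightarrow> complex" and \<mu> :: "nat \<Rightarrow> real"
  assumes a: "summable (\<lambda>k. cmod (a k))"
begin

text \<open>
  An absolutely convergent trigonometric series is the uniform limit of its partial sums; uniform
  convergence is stronger than convergence in the Besicovitch seminorm, so the series is almost
  periodic and its coefficients can be read off from the partial sums.
\<close>

lemma exp_series_uniform_limit:
  "uniform_limit UNIV (\<lambda>N. exp_sum {..<N} a \<mu>) (exp_series a \<mu>) sequentially"
  unfolding exp_sum_def exp_series_def
  using a by (intro Weierstrass_m_test) (auto simp: norm_mult)

lemma locally_integrable_exp_series: "locally_integrable (exp_series a \<mu>)"
proof -
  have "continuous_on UNIV (exp_series a \<mu>)"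
  proof (rule uniform_limit_theorem[OF _ exp_series_uniform_limit])
    show "\<forall>\<^sub>F N in sequentially. continuous_on UNIV (exp_sum {..<N} a \<mu>)"
      unfolding exp_sum_def by (intro always_eventually allI continuous_intros)
  qed simp
  then show ?thesis by (rule continuous_imp_locally_integrable)
qed

lemma exp_series_mean_dist: "(\<lambda>N. mean_dist (exp_series a \<mu>) (exp_sum {..<N} a \<mu>)) \<longlonglongrightarrow> 0"
proof (rule order_tendstoI)
  fix r :: ereal assume "r < 0"
  then show "\<forall>\<^sub>F N in sequentially. r < mean_dist (exp_series a \<mu>) (exp_sum {..<N} a \<mu>)"
    by (intro always_eventually allI less_le_trans[OF _ mean_dist_nonneg])
next
  fix r :: ereal assume "0 < r"
  then obtain e where e: "0 < e" "ereal e < r"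
    by (metis ereal_dense2 ereal_less(2))
  show "\<forall>\<^sub>F N in sequentially. mean_dist (exp_series a \<mu>) (exp_sum {..<N} a \<mu>) < r"
    using uniform_limitD[OF exp_series_uniform_limit e(1)]
  proof eventually_elim
    case (elim N)
    then have "mean_dist (exp_series a \<mu>) (exp_sum {..<N} a \<mu>) \<le> ereal e"
      by (intro mean_dist_le locally_integrable_exp_series locally_integrable_exp_sum)
         (simp add: dist_norm norm_minus_commute less_imp_le)
    then show ?case using e(2) by (rule le_less_trans)
  qed
qed

lemma B_ap_exp_series: "B_ap (exp_series a \<mu>)"
  unfolding B_ap_alt
  by (intro conjI exI[of _ "\<lambda>N. exp_sum {..<N} a \<mu>"] allI locally_integrable_exp_series
        exp_series_mean_dist trig_sum_exp_sum finite_lessThan)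

lemma fourier_coeff_exp_series: 
  assumes "inj \<mu>"
  shows "fourier_coeff (exp_series a \<mu>) (\<mu> k) = a k"
    and "l \<notin> range \<mu> \<Longrightarrow> fourier_coeff (exp_series a \<mu>) l = 0"
proof -
  have lim: "(\<lambda>N. \<Sum>k<N. if \<mu> k = l then a k else 0) \<longlonglongrightarrow> fourier_coeff (exp_series a \<mu>) l" for l
    using fourier_coeff_limit(2)[OF locally_integrable_exp_series, of "\<lambda>N. {..<N}" "\<lambda>N. a" "\<lambda>N. \<mu>"]
      exp_series_mean_dist by simp
  have "\<forall>\<^sub>F N in sequentially. (\<Sum>j<N. if \<mu> j = \<mu> k then a j else 0) = a k"
    using eventually_gt_at_top[of k]
    by eventually_elim (use assms in \<open>simp add: inj_eq sum.delta\<close>)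
  then show "fourier_coeff (exp_series a \<mu>) (\<mu> k) = a k"
    using LIMSEQ_unique[OF lim tendsto_eventually] by blast
  show "fourier_coeff (exp_series a \<mu>) l = 0" if "l \<notin> range \<mu>"
  proof -
    have "(\<Sum>k<N. if \<mu> k = l then a k else 0) = 0" for N
      using that by (intro sum.neutral) auto
    then show ?thesis using LIMSEQ_unique[OF lim[of l]] by simp
  qed
qed

end

lemma
  assumes "finite I"
  shows B_ap_exp_sum: "B_ap (exp_sum I a \<mu>)"
    and fourier_coeff_exp_sum: "fourier_coeff (exp_sum I a \<mu>) l = (\<Sum>k\<in>I. if \<mu> k = l then a k else 0)"
proof -
  have "mean_dist (exp_sum I a \<mu>) (exp_sum I a \<mu>) = 0"
    using mean_dist_le[of "exp_sum I a \<mu>" "exp_sum I a \<mu>" 0]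
    by (intro antisym mean_dist_nonneg) (simp add: locally_integrable_exp_sum zero_ereal_def)
  then have lim: "(\<lambda>N::nat. mean_dist (exp_sum I a \<mu>) (exp_sum I a \<mu>)) \<longlonglongrightarrow> 0" by simp
  then show "B_ap (exp_sum I a \<mu>)"
    unfolding B_ap_alt
    by (intro conjI exI[of _ "\<lambda>N. exp_sum I a \<mu>"] allI locally_integrable_exp_sum trig_sum_exp_sum assms)
  show "fourier_coeff (exp_sum I a \<mu>) l = (\<Sum>k\<in>I. if \<mu> k = l then a k else 0)"
    using LIMSEQ_unique[OF fourier_coeff_limit(2)[OF locally_integrable_exp_sum assms lim] tendsto_const] by simp
qed

section \<open>Extended nonnegative sums and integrals\<close>

lemma ennreal_infsum_leI:
  fixes f :: "'a \<Rightarrow> ennreal"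
  assumes "\<And>F. finite F \<Longrightarrow> sum f F \<le> B"
  shows "infsum f UNIV \<le> B"
  using assms by (subst nonneg_infsum_complete) (auto intro: SUP_least)

lemma ennreal_sum_le_infsum:
  fixes f :: "'a \<Rightarrow> ennreal"
  assumes "finite F"
  shows "sum f F \<le> infsum f UNIV"
  using assms by (subst nonneg_infsum_complete) (auto intro: SUP_upper)

text \<open>
  A finite sum over any index set that is injected into the naturals by \<open>h\<close> is a partial sum of a
  rearranged geometric series. This distributes a total mass of at most 1 over the integers.
\<close>

lemma sum_half_powers_le_1:
  assumes "finite F" "inj_on h F"
  shows "(\<Sum>k\<in>F. (1 / 2 :: real) ^ Suc (h k)) \<le> 1"
proof -
  have "(\<Sum>k\<in>F. (1 / 2 :: real) ^ Suc (h k)) = (\<Sum>j\<in>h ` F. (1 / 2) ^ Suc j)"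
    using assms(2) by (simp add: sum.reindex)
  also have "\<dots> \<le> (\<Sum>j. (1 / 2) ^ Suc j)"
    using assms(1) power_half_series by (intro sum_le_suminf) (auto simp: sums_iff)
  also have "\<dots> = 1"
    using power_half_series by (simp add: sums_iff)
  finally show ?thesis .
qed

lemma nn_set_integral_eq:
  fixes f :: "'a \<Rightarrow> real"
  assumes "set_integrable M A f" "\<And>x. x \<in> A \<Longrightarrow> 0 \<le> f x"
  shows "(\<integral>\<^sup>+x\<in>A. ennreal (f x) \<partial>M) = ennreal (LINT x:A|M. f x)"
proof -
  have "(\<integral>\<^sup>+x\<in>A. ennreal (f x) \<partial>M) = (\<integral>\<^sup>+x. ennreal (indicator A x *\<^sub>R f x) \<partial>M)"
    by (intro nn_integral_cong) (auto simp: indicator_def)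
  also have "\<dots> = ennreal (LINT x:A|M. f x)"
    using assms unfolding set_integrable_def set_lebesgue_integral_def
    by (intro nn_integral_eq_integral) (auto simp: indicator_def)
  finally show ?thesis .
qed

text \<open>
  This compares the modulus of smoothness, a supremum over uncountably many shifts and weights, with
  explicit functions.
\<close>

lemma nn_set_integral_mono_on:
  fixes f g :: "'a \<Rightarrow> ennreal"
  assumes "\<And>x. x \<in> A \<Longrightarrow> f x \<le> g x"
  shows "(\<integral>\<^sup>+x\<in>A. f x \<partial>M) \<le> (\<integral>\<^sup>+x\<in>A. g x \<partial>M)"
  by (intro nn_integral_mono) (auto simp: assms split: split_indicator)

section \<open>Admissible weights\<close>

text \<open>
  Convexity and \<open>M 0 = 0\<close> make \<open>M\<close> grow at least linearly beyond a point \<open>u0\<close> with \<open>M u0 \<ge> 1\<close>. For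
  a slope \<open>v \<le> 1 / u0\<close> the difference \<open>u * v - M u\<close> is thus nonpositive for \<open>u > u0\<close>, and for
  \<open>u \<le> u0\<close> it is at most \<open>u0 * v\<close>, which is small.
\<close>

lemma small_conjugate:
  assumes "orlicz_function M" "e > 0"
  shows "\<exists>v>0. conjugate M v \<le> ennreal e"
proof -
  have nonneg: "\<And>t. t \<ge> 0 \<Longrightarrow> 0 \<le> M t" and conv: "convex_on {0..} M" and "M 0 = 0"
    and "filterlim M at_top at_top"
    using assms(1) by (auto simp: orlicz_function_def)
  then have "\<forall>\<^sub>F u in at_top. u > 0 \<and> M u \<ge> 1"
    by (intro eventually_conj eventually_gt_at_top) (simp add: filterlim_at_top)
  then obtain u0 where u0: "u0 > 0" "M u0 \<ge> 1"
    by (auto dest: eventually_happens)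
  \<comment> \<open>The first bound serves \<open>u \<le> u0\<close>, the second one \<open>u > u0\<close>.\<close>
  define v where "v = min (e / u0) (1 / u0)"
  have "v > 0" using assms u0 by (simp add: v_def)
  moreover have "u * v - M u \<le> e" if "u \<ge> 0" for u
  proof (cases "u \<le> u0")
    case True
    have "u * v \<le> u0 * (e / u0)"
      using True that u0 \<open>v > 0\<close> by (intro mult_mono) (auto simp: v_def)
    then show ?thesis using nonneg[OF that] u0 by simp
  next
    case False
    have "M ((1 - u0 / u) *\<^sub>R 0 + (u0 / u) *\<^sub>R u) \<le> (1 - u0 / u) * M 0 + (u0 / u) * M u"
      using False u0 by (intro convex_onD[OF conv]) auto
    then have "M u0 \<le> (u0 / u) * M u"
      using u0 False \<open>M 0 = 0\<close> by simp
    then have "1 \<le> (u0 / u) * M u"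
      using u0(2) by linarith
    then have "u / u0 \<le> M u"
      using u0 False by (simp add: field_simps)
    moreover have "u * v \<le> u * (1 / u0)"
      using that by (intro mult_left_mono) (auto simp: v_def)
    ultimately show ?thesis using assms(2) by simp
  qed
  then have "conjugate M v \<le> ennreal e"
    unfolding conjugate_def by (intro SUP_least ennreal_leI) auto
  ultimately show ?thesis by blast
qed

lemma weights_nonempty:
  assumes "\<forall>k. orlicz_function (M k)"
  shows "weights M \<noteq> {}"
proof -
  have "\<forall>k. \<exists>v>0. conjugate (M k) v \<le> ennreal ((1 / 2) ^ Suc (to_nat k))"
    using assms by (intro allI small_conjugate) auto
  then obtain \<gamma> where \<gamma>: "\<And>k. \<gamma> k > 0" "\<And>k. conjugate (M k) (\<gamma> k) \<le> ennreal ((1 / 2) ^ Suc (to_nat k))"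
    by metis
  have "(\<Sum>\<^sub>\<infinity>k. conjugate (M k) (\<gamma> k)) \<le> 1"
  proof (rule ennreal_infsum_leI)
    fix F :: "int set" assume F: "finite F"
    have "(\<Sum>k\<in>F. conjugate (M k) (\<gamma> k)) \<le> (\<Sum>k\<in>F. ennreal ((1 / 2) ^ Suc (to_nat k)))"
      by (intro sum_mono \<gamma>)
    also have "\<dots> = ennreal (\<Sum>k\<in>F. (1 / 2) ^ Suc (to_nat k))"
      by (intro sum_ennreal) simp
    also have "\<dots> \<le> 1"
      using sum_half_powers_le_1[OF F inj_on_subset[OF inj_to_nat]] by (simp add: ennreal_le_1)
    finally show "(\<Sum>k\<in>F. conjugate (M k) (\<gamma> k)) \<le> 1" .
  qed
  with \<gamma>(1) show ?thesis by (auto simp: weights_def)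
qed

lemma weights_pos: "\<gamma> \<in> weights M \<Longrightarrow> \<gamma> k > 0"
  by (simp add: weights_def)

text \<open>
  Testing the conjugate at the single point \<open>u = 1\<close> bounds each weight.
\<close>

lemma weights_le:
  assumes "\<gamma> \<in> weights M"
  shows "\<gamma> k \<le> 1 + M k 1"
proof -
  have "ennreal (1 * \<gamma> k - M k 1) \<le> conjugate (M k) (\<gamma> k)"
    unfolding conjugate_def by (rule SUP_upper) simp
  also have "\<dots> \<le> (\<Sum>\<^sub>\<infinity>k. conjugate (M k) (\<gamma> k))"
    using ennreal_sum_le_infsum[of "{k}" "\<lambda>k. conjugate (M k) (\<gamma> k)"] by simp
  also have "\<dots> \<le> 1"
    using assms by (simp add: weights_def)
  finally show ?thesis by (simp add: ennreal_le_1)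
qed

section \<open>The direct inequality\<close>

lemma smooth_phi_nonneg: "smooth_phi \<alpha> t \<ge> 0"
  by (simp add: smooth_phi_def)

lemma smooth_phi_le: 
  assumes "\<alpha> > 0"
  shows "smooth_phi \<alpha> t \<le> 2 powr \<alpha>"
proof -
  have "(1 - cos t) powr (\<alpha> / 2) \<le> 2 powr (\<alpha> / 2)"
    using assms cos_ge_minus_one[of t] by (intro powr_mono2) auto
  then have "smooth_phi \<alpha> t \<le> 2 powr (\<alpha> / 2) * 2 powr (\<alpha> / 2)"
    unfolding smooth_phi_def by (intro mult_left_mono) auto
  then show ?thesis by (simp flip: powr_add)
qed

lemma smooth_phi_mono:
  assumes "\<alpha> > 0" "\<bar>t\<bar> \<le> u" "u \<le> pi"
  shows "smooth_phi \<alpha> t \<le> smooth_phi \<alpha> u"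
proof -
  have "cos u \<le> cos \<bar>t\<bar>"
    using assms by (intro cos_monotone_0_pi_le) auto
  then show ?thesis
    unfolding smooth_phi_def using assms(1) by (intro mult_left_mono powr_mono2) auto
qed

lemma cos_powr_integral_minus: "cos_powr_integral \<beta> (- a) = cos_powr_integral \<beta> a"
  by (simp add: cos_powr_integral_def)

lemma smooth_phi_integral:
  assumes "\<alpha> > 0"
  shows "set_integrable lborel {0..pi} (\<lambda>u. smooth_phi \<alpha> (a * u) * sin u)"
    and "(LBINT u:{0..pi}. smooth_phi \<alpha> (a * u) * sin u) = 2 powr (\<alpha> / 2) * cos_powr_integral (\<alpha> / 2) a"
  using cos_powr_set_integrable[of "\<alpha> / 2" a] assms
  by (auto simp: smooth_phi_def cos_powr_integral_def mult.assoc)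

context
  fixes lam :: "int \<Rightarrow> real" and n :: nat
  assumes lam: "exponent_sequence lam" and n: "n \<ge> 1"
begin

text \<open>
  The infimum runs over \<open>k \<ge> n\<close>, but by evenness of the cosine it also bounds the integrals for
  \<open>k \<le> -n\<close>.
\<close>

lemma I_const_le_int:
  assumes "0 < \<beta>" "\<bar>k\<bar> \<ge> int n"
  shows "I_const lam n \<beta> \<le> cos_powr_integral \<beta> (lam k / lam (int n))"
proof (cases "k \<ge> 0")
  case True
  then show ?thesis using I_const_le[OF lam n, of \<beta> "nat k"] assms by simp
next
  case False
  have "lam k = - lam (- k)"
    using lam unfolding exponent_sequence_def by (metis minus_minus)
  then show ?thesis
    using I_const_le[OF lam n, of \<beta> "nat (- k)"] assms False
    by (simp add: cos_powr_integral_minus)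
qed

text \<open>
  For each \<open>u\<close>, the shift \<open>h = u / lam n\<close>, the weights \<open>\<gamma>\<close> and the finite set \<open>F\<close> give a lower bound
  for the modulus of smoothness. Finite sets suffice, as a sum of nonnegative extended reals is the
  supremum of its finite partial sums; so no interchange of an infinite sum and the integral occurs.
\<close>

lemma modulus_integral_ge_sum:
  assumes \<alpha>: "\<alpha> > 0" and \<gamma>: "\<gamma> \<in> weights M" and F: "finite F"
  shows "ennreal (\<Sum>k\<in>F. \<gamma> k * cmod (fourier_coeff f (lam k))
             * (2 powr (\<alpha> / 2) * cos_powr_integral (\<alpha> / 2) (lam k / lam (int n))))
           \<le> modulus_integral lam M \<alpha> n f"
proof -
  define w where "w = (\<lambda>k. \<gamma> k * cmod (fourier_coeff f (lam k)))"
  have w: "w k \<ge> 0" for k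
    using weights_pos[OF \<gamma>, of k] by (simp add: w_def)
  have intk: "set_integrable lborel {0..pi} (\<lambda>u. w k * (smooth_phi \<alpha> (lam k / lam (int n) * u) * sin u))" for k
    by (intro set_integrable_mult_right smooth_phi_integral(1)[OF \<alpha>])
  then have int: "set_integrable lborel {0..pi} (\<lambda>u. \<Sum>k\<in>F. w k * (smooth_phi \<alpha> (lam k / lam (int n) * u) * sin u))"
    unfolding set_integrable_def scaleR_sum_right
    by (intro Bochner_Integration.integrable_sum)
  have "(\<Sum>k\<in>F. w k * (2 powr (\<alpha> / 2) * cos_powr_integral (\<alpha> / 2) (lam k / lam (int n))))
      = (\<Sum>k\<in>F. LBINT u:{0..pi}. w k * (smooth_phi \<alpha> (lam k / lam (int n) * u) * sin u))"
    by (simp only: set_integral_mult_right smooth_phi_integral(2)[OF \<alpha>])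
  also have "\<dots> = (LBINT u:{0..pi}. \<Sum>k\<in>F. w k * (smooth_phi \<alpha> (lam k / lam (int n) * u) * sin u))"
    unfolding set_lebesgue_integral_def scaleR_sum_right
    using intk unfolding set_integrable_def by (rule Bochner_Integration.integral_sum [symmetric])
  also have "ennreal \<dots> = (\<integral>\<^sup>+u\<in>{0..pi}. ennreal (\<Sum>k\<in>F. w k * (smooth_phi \<alpha> (lam k / lam (int n) * u) * sin u)) \<partial>lborel)"
    by (rule nn_set_integral_eq [symmetric, OF int])
       (auto intro!: sum_nonneg mult_nonneg_nonneg w smooth_phi_nonneg sin_ge_zero)
  also have "\<dots> \<le> modulus_integral lam M \<alpha> n f"
    unfolding modulus_integral_def
  proof (rule nn_set_integral_mono_on)
    fix u :: real assume u: "u \<in> {0..pi}"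
    define h where "h = u / lam (int n)"
    have h: "h \<ge> 0" using u lam_pos[OF lam n] by (simp add: h_def)
    have "(\<Sum>k\<in>F. ennreal (\<gamma> k * smooth_phi \<alpha> (lam k * h) * cmod (fourier_coeff f (lam k))))
        \<le> (\<Sum>\<^sub>\<infinity>k. ennreal (\<gamma> k * smooth_phi \<alpha> (lam k * h) * cmod (fourier_coeff f (lam k))))"
      by (rule ennreal_sum_le_infsum[OF F])
    also have "\<dots> \<le> modulus_smoothness lam M \<alpha> f h"
      unfolding modulus_smoothness_def using h by (intro SUP_upper2[where i = h] SUP_upper \<gamma>) auto
    finally have "(\<Sum>k\<in>F. ennreal (\<gamma> k * smooth_phi \<alpha> (lam k * h) * cmod (fourier_coeff f (lam k))))
        \<le> modulus_smoothness lam M \<alpha> f h" .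
    also have "(\<Sum>k\<in>F. ennreal (\<gamma> k * smooth_phi \<alpha> (lam k * h) * cmod (fourier_coeff f (lam k))))
        = ennreal (\<Sum>k\<in>F. w k * smooth_phi \<alpha> (lam k * h))"
      by (subst sum_ennreal)
         (auto simp: w_def mult_ac intro!: mult_nonneg_nonneg smooth_phi_nonneg less_imp_le[OF weights_pos[OF \<gamma>]])
    finally have "ennreal (\<Sum>k\<in>F. w k * smooth_phi \<alpha> (lam k * h)) * ennreal (sin u)
        \<le> modulus_smoothness lam M \<alpha> f h * ennreal (sin u)"
      by (rule mult_right_mono) simp
    then show "ennreal (\<Sum>k\<in>F. w k * (smooth_phi \<alpha> (lam k / lam (int n) * u) * sin u))
        \<le> modulus_smoothness lam M \<alpha> f (u / lam (int n)) * ennreal (sin u)"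
      using u by (simp add: h_def sin_ge_zero sum_distrib_right mult.assoc flip: ennreal_mult'')
  qed
  finally show ?thesis by (simp add: w_def)
qed

text \<open>
  The competitor \<open>g\<close> is the partial sum of the Fourier series of \<open>f\<close> over \<open>\<bar>k\<bar> < n\<close>. It cancels
  these coefficients of \<open>f\<close> and leaves the others, to which the bound \<open>I_const_le_int\<close> applies
  termwise.
\<close>

lemma direct_inequality:
  assumes \<alpha>: "\<alpha> > 0" and f: "B_ap f"
  shows "best_approx lam M n f
           \<le> ennreal (1 / (2 powr (\<alpha> / 2) * I_const lam n (\<alpha> / 2))) * modulus_integral lam M \<alpha> n f"
proof -
  define J where "J = {- int n <..< int n}"
  define g where "g = exp_sum J (\<lambda>k. fourier_coeff f (lam k)) lam"
  define C where "C = 2 powr (\<alpha> / 2) * I_const lam n (\<alpha> / 2)"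
  have C: "C > 0" using I_const_pos[OF lam n, of "\<alpha> / 2"] \<alpha> by (simp add: C_def)
  have fin: "finite J" by (simp add: J_def)
  note mono = exponent_sequence_strict_mono[OF lam]
  have inj: "lam k = lam l \<longleftrightarrow> k = l" for k l
    using strict_mono_eq[OF mono] .
  have g: "B_ap g" unfolding g_def by (rule B_ap_exp_sum[OF fin])
  have coeff_g: "fourier_coeff g l = (\<Sum>k\<in>J. if lam k = l then fourier_coeff f (lam k) else 0)" for l
    unfolding g_def by (rule fourier_coeff_exp_sum[OF fin])
  have exps: "fourier_exponents g \<subseteq> lam ` J"
  proof
    fix l assume "l \<in> fourier_exponents g"
    then have "(\<Sum>k\<in>J. if lam k = l then fourier_coeff f (lam k) else 0) \<noteq> 0"
      by (simp add: fourier_exponents_def coeff_g)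
    then obtain k where "k \<in> J" "lam k = l"
      by (auto elim!: sum.not_neutral_contains_not_neutral split: if_splits)
    then show "l \<in> lam ` J" by blast
  qed
  have "lam ` J \<subseteq> {- lam (int n)<..<lam (int n)}"
  proof -
    have "- lam (int n) = lam (- int n)" using lam by (simp add: exponent_sequence_def)
    then show ?thesis using strict_mono_less[OF mono] by (auto simp: J_def)
  qed
  then have "best_approx lam M n f \<le> norm_M lam M (\<lambda>x. f x - g x)"
    unfolding best_approx_def using exps g by (intro INF_lower) (auto simp: B_ap_spec_def)
  also have "\<dots> \<le> ennreal (1 / C) * modulus_integral lam M \<alpha> n f"
    unfolding norm_M_def
  proof (intro SUP_least ennreal_infsum_leI)
    fix \<gamma> and F :: "int set" assume \<gamma>: "\<gamma> \<in> weights M" and F: "finite F"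
    define w where "w = (\<lambda>k. \<gamma> k * cmod (fourier_coeff f (lam k)))"
    have w: "w k \<ge> 0" for k
      using weights_pos[OF \<gamma>, of k] by (simp add: w_def)
    have "fourier_coeff (\<lambda>x. f x - g x) (lam k) = (if k \<in> J then 0 else fourier_coeff f (lam k))" for k
      using fin by (simp add: fourier_coeff_diff[OF f g] coeff_g inj)
    then have "(\<Sum>k\<in>F. ennreal (\<gamma> k * cmod (fourier_coeff (\<lambda>x. f x - g x) (lam k))))
        = (\<Sum>k\<in>F. if k \<in> J then 0 else ennreal (w k))"
      by (intro sum.cong) (auto simp: w_def)
    also have "\<dots> = (\<Sum>k\<in>F - J. ennreal (w k))"
      using F by (intro sum.mono_neutral_cong_right) auto
    also have "\<dots> = ennreal (\<Sum>k\<in>F - J. w k)"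
      by (intro sum_ennreal w)
    also have "\<dots> = ennreal (1 / C) * ennreal (\<Sum>k\<in>F - J. w k * C)"
      using C w by (simp add: sum_nonneg flip: ennreal_mult sum_distrib_right)
    also have "\<dots> \<le> ennreal (1 / C) * ennreal (\<Sum>k\<in>F - J. w k *
          (2 powr (\<alpha> / 2) * cos_powr_integral (\<alpha> / 2) (lam k / lam (int n))))"
      unfolding C_def using \<alpha>
      by (intro mult_left_mono ennreal_leI sum_mono w I_const_le_int) (auto simp: J_def)
    also have "\<dots> \<le> ennreal (1 / C) * modulus_integral lam M \<alpha> n f"
      unfolding w_def using F by (intro mult_left_mono modulus_integral_ge_sum \<alpha> \<gamma>) auto
    finally show "(\<Sum>k\<in>F. ennreal (\<gamma> k * cmod (fourier_coeff (\<lambda>x. f x - g x) (lam k))))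
        \<le> ennreal (1 / C) * modulus_integral lam M \<alpha> n f" .
  qed
  finally show ?thesis unfolding C_def .
qed

text \<open>
  Functions with exponents in the open interval \<open>(- lam n, lam n)\<close> cannot change the coefficient at
  \<open>lam n\<close>.
\<close>

lemma weight_le_best_approx:
  assumes f: "B_ap f" and \<gamma>: "\<gamma> \<in> weights M"
  shows "ennreal (\<gamma> (int n) * cmod (fourier_coeff f (lam (int n)))) \<le> best_approx lam M n f"
  unfolding best_approx_def
proof (rule INF_greatest)
  fix g assume "g \<in> {g \<in> B_ap_spec lam. fourier_exponents g \<subseteq> {- lam (int n)<..<lam (int n)}}"
  then have g: "B_ap g" and "lam (int n) \<notin> fourier_exponents g"
    by (auto simp: B_ap_spec_def)
  then have "fourier_coeff (\<lambda>x. f x - g x) (lam (int n)) = fourier_coeff f (lam (int n))"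
    by (simp add: fourier_coeff_diff[OF f g] fourier_exponents_def)
  then have "ennreal (\<gamma> (int n) * cmod (fourier_coeff f (lam (int n))))
      = (\<Sum>k\<in>{int n}. ennreal (\<gamma> k * cmod (fourier_coeff (\<lambda>x. f x - g x) (lam k))))"
    by simp
  also have "\<dots> \<le> (\<Sum>\<^sub>\<infinity>k. ennreal (\<gamma> k * cmod (fourier_coeff (\<lambda>x. f x - g x) (lam k))))"
    by (rule ennreal_sum_le_infsum) simp
  also have "\<dots> \<le> norm_M lam M (\<lambda>x. f x - g x)"
    unfolding norm_M_def by (rule SUP_upper[OF \<gamma>])
  finally show "ennreal (\<gamma> (int n) * cmod (fourier_coeff f (lam (int n)))) \<le> norm_M lam M (\<lambda>x. f x - g x)" .
qed

end

section \<open>Sharpness of the constant\<close>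

context
  fixes lam :: "int \<Rightarrow> real" and M :: "int \<Rightarrow> real \<Rightarrow> real" and n :: nat
  assumes lam: "exponent_sequence lam" and n: "n \<ge> 1"
    and M: "\<forall>k. orlicz_function (M k)"
begin

text \<open>
  The extremal functions: coefficient 1 at the frequency \<open>lam n\<close> (index \<open>j = n - 1\<close>, as \<open>j\<close> stands
  for \<open>lam (j + 1)\<close>) and small positive coefficients at all other positive frequencies. The
  denominators \<open>1 + M (j + 1) 1\<close> bound the corresponding weights by \<open>weights_le\<close>, so the weighted
  sum of the small terms is at most \<open>\<epsilon>\<close> for all admissible weights simultaneously.
\<close>

definition peak_coeff :: "real \<Rightarrow> nat \<Rightarrow> real" where
  "peak_coeff \<epsilon> j =
     (if j = n - 1 then 1 else \<epsilon> * (1 / 2) ^ Suc j / (1 + M (int (Suc j)) 1))"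

definition peak_function :: "real \<Rightarrow> real \<Rightarrow> complex" where
  "peak_function \<epsilon> = exp_series (\<lambda>j. of_real (peak_coeff \<epsilon> j)) (\<lambda>j. lam (int (Suc j)))"

definition max_weight :: real where
  "max_weight = (SUP \<gamma>\<in>weights M. \<gamma> (int n))"

lemma M_1_nonneg: "M k 1 \<ge> 0"
  using M by (simp add: orlicz_function_def)

lemma bdd_weights: "bdd_above ((\<lambda>\<gamma>. \<gamma> (int n)) ` weights M)"
  using weights_le by (intro bdd_aboveI2) 

lemma weight_le_max_weight: "\<gamma> \<in> weights M \<Longrightarrow> \<gamma> (int n) \<le> max_weight"
  unfolding max_weight_def by (rule cSUP_upper[OF _ bdd_weights])

lemma max_weight_pos: "max_weight > 0"
proof -
  obtain \<gamma> where "\<gamma> \<in> weights M" using weights_nonempty[OF M] by blast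
  then show ?thesis using weights_pos weight_le_max_weight less_le_trans by blast
qed

lemma peak_coeff_pos: "\<epsilon> > 0 \<Longrightarrow> peak_coeff \<epsilon> j > 0"
  using M_1_nonneg[of "int (Suc j)"] by (simp add: peak_coeff_def)

lemma peak_coeff_summable:
  assumes "\<epsilon> > 0"
  shows "summable (\<lambda>j. cmod (of_real (peak_coeff \<epsilon> j)))"
proof (rule summable_comparison_test')
  show "summable (\<lambda>j. \<epsilon> * (1 / 2 :: real) ^ Suc j)"
    using power_half_series by (intro summable_mult) (auto simp: sums_iff)
  fix j assume "j \<ge> n"
  then have "j \<noteq> n - 1" using n by simp
  moreover have "\<epsilon> * (1 / 2) ^ Suc j / (1 + M (int (Suc j)) 1) \<le> \<epsilon> * (1 / 2) ^ Suc j / 1"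
    using assms M_1_nonneg[of "int (Suc j)"] by (intro divide_left_mono) auto
  ultimately have "peak_coeff \<epsilon> j \<le> \<epsilon> * (1 / 2) ^ Suc j"
    by (simp only: peak_coeff_def if_False div_by_1)
  then show "norm (cmod (of_real (peak_coeff \<epsilon> j))) \<le> \<epsilon> * (1 / 2) ^ Suc j"
    using peak_coeff_pos[OF assms, of j] by simp
qed

context
  fixes \<epsilon> :: real
  assumes \<epsilon>: "\<epsilon> > 0"
begin

lemma B_ap_peak: "B_ap (peak_function \<epsilon>)"
  unfolding peak_function_def by (rule B_ap_exp_series[OF peak_coeff_summable[OF \<epsilon>]])

lemma inj_peak_freq: "inj (\<lambda>j. lam (int (Suc j)))"
  using strict_mono_eq[OF exponent_sequence_strict_mono[OF lam]] by (auto intro!: injI)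

lemma fourier_coeff_peak:
  "fourier_coeff (peak_function \<epsilon>) (lam k) = (if k \<ge> 1 then of_real (peak_coeff \<epsilon> (nat (k - 1))) else 0)"
proof (cases "k \<ge> 1")
  case True
  then have "k = int (Suc (nat (k - 1)))" by simp
  then show ?thesis
    using True fourier_coeff_exp_series(1)[OF peak_coeff_summable[OF \<epsilon>] inj_peak_freq, of "nat (k - 1)"]
    by (simp add: peak_function_def)
next
  case False
  then have "lam k \<notin> range (\<lambda>j. lam (int (Suc j)))"
    using strict_mono_eq[OF exponent_sequence_strict_mono[OF lam]] by auto
  then show ?thesis
    using False fourier_coeff_exp_series(2)[OF peak_coeff_summable[OF \<epsilon>] inj_peak_freq]
    by (simp add: peak_function_def)
qed

lemma cmod_fourier_coeff_peak:
  "cmod (fourier_coeff (peak_function \<epsilon>) (lam k)) = (if k \<ge> 1 then peak_coeff \<epsilon> (nat (k - 1)) else 0)"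
  using peak_coeff_pos[OF \<epsilon>, of "nat (k - 1)"] by (simp add: fourier_coeff_peak)

lemma fourier_exponents_peak: "fourier_exponents (peak_function \<epsilon>) \<subseteq> range lam"
  using fourier_coeff_exp_series(2)[OF peak_coeff_summable[OF \<epsilon>] inj_peak_freq]
  unfolding fourier_exponents_def peak_function_def by blast

lemma full_peak: "full_fourier_series lam (peak_function \<epsilon>)"
  unfolding full_fourier_series_def cmod_fourier_coeff_peak
  by (simp add: peak_coeff_pos[OF \<epsilon>])

text \<open>
  The term at \<open>n\<close> is at most \<open>max_weight * v\<close>, and the remaining ones are dominated by \<open>W * \<epsilon>\<close> times
  a geometric series of sum 1. The multipliers \<open>w\<close> are constant 1 for the norm and the values of
  \<open>smooth_phi\<close> for the modulus of smoothness.
\<close>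

lemma peak_sum_le:
  assumes \<gamma>: "\<gamma> \<in> weights M" and w: "\<And>k. 0 \<le> w k" "\<And>k. w k \<le> W" "w (int n) \<le> v"
  shows "(\<Sum>\<^sub>\<infinity>k. ennreal (\<gamma> k * w k * cmod (fourier_coeff (peak_function \<epsilon>) (lam k))))
           \<le> ennreal (max_weight * v + W * \<epsilon>)"
proof (rule ennreal_infsum_leI)
  fix F :: "int set" assume F: "finite F"
  define t where "t = (\<lambda>k. \<gamma> k * w k * cmod (fourier_coeff (peak_function \<epsilon>) (lam k)))"
  define e :: "int \<Rightarrow> real" where "e = (\<lambda>k. (1 / 2) ^ Suc (nat (k - 1)))"
  have W: "W \<ge> 0" using w(1)[of 0] w(2)[of 0] by linarith
  have v: "v \<ge> 0" using w(1)[of "int n"] w(3) by linarith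
  have t_nonneg: "t k \<ge> 0" for k
    using weights_pos[OF \<gamma>, of k] w(1)[of k] by (simp add: t_def)
  have t0: "t k = 0" if "k < 1" for k
    using that by (simp add: t_def cmod_fourier_coeff_peak)
  have tn: "t (int n) \<le> max_weight * v"
  proof -
    have "nat (int n - 1) = n - 1" by simp
    then have "t (int n) = \<gamma> (int n) * w (int n)"
      using n by (simp add: t_def cmod_fourier_coeff_peak peak_coeff_def)
    also have "\<dots> \<le> max_weight * v"
      using weight_le_max_weight[OF \<gamma>] w(1,3) max_weight_pos by (intro mult_mono) auto
    finally show ?thesis .
  qed
  have te: "t k \<le> W * \<epsilon> * e k" if "k \<ge> 1" "k \<noteq> int n" for k
  proof -
    have "nat (k - 1) \<noteq> n - 1" "int (Suc (nat (k - 1))) = k" using that n by auto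
    then have "t k = (\<gamma> k * w k) * (\<epsilon> * e k / (1 + M k 1))"
      using that by (simp add: t_def cmod_fourier_coeff_peak peak_coeff_def e_def)
    also have "\<dots> \<le> ((1 + M k 1) * W) * (\<epsilon> * e k / (1 + M k 1))"
      using weights_le[OF \<gamma>, of k] weights_pos[OF \<gamma>, of k] w(1,2)[of k] \<epsilon> M_1_nonneg[of k] W
      by (intro mult_right_mono mult_mono) (auto simp: e_def)
    also have "\<dots> = W * \<epsilon> * e k"
      using M_1_nonneg[of k] by simp
    finally show ?thesis .
  qed
  have "sum t F = sum t (F \<inter> {1..})"
    using F t0 by (intro sum.mono_neutral_right) (auto simp: not_le)
  also have "\<dots> = sum t (F \<inter> {1..} \<inter> {int n}) + sum t (F \<inter> {1..} - {int n})"
    using F by (intro sum.Int_Diff) auto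
  also have "sum t (F \<inter> {1..} \<inter> {int n}) \<le> sum t {int n}"
    using t_nonneg by (intro sum_mono2) auto
  also have "sum t {int n} \<le> max_weight * v" using tn by simp
  also have "sum t (F \<inter> {1..} - {int n}) \<le> (\<Sum>k\<in>F \<inter> {1..} - {int n}. W * \<epsilon> * e k)"
    by (intro sum_mono te) auto
  also have "\<dots> = W * \<epsilon> * sum e (F \<inter> {1..} - {int n})"
    by (simp add: sum_distrib_left)
  also have "\<dots> \<le> W * \<epsilon> * 1"
    unfolding e_def using F W \<epsilon>
    by (intro mult_left_mono sum_half_powers_le_1) (auto intro!: inj_onI)
  finally have "sum t F \<le> max_weight * v + W * \<epsilon>" by simp
  then show "(\<Sum>k\<in>F. ennreal (\<gamma> k * w k * cmod (fourier_coeff (peak_function \<epsilon>) (lam k))))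
      \<le> ennreal (max_weight * v + W * \<epsilon>)"
    using t_nonneg by (subst sum_ennreal) (auto simp: t_def intro: ennreal_leI)
qed

lemma peak_in_space: "peak_function \<epsilon> \<in> BS_space lam M"
proof -
  have "norm_M lam M (peak_function \<epsilon>) \<le> ennreal (max_weight * 1 + 1 * \<epsilon>)"
    unfolding norm_M_def using peak_sum_le[of _ "\<lambda>_. 1" 1 1] by (intro SUP_least) simp
  also have "\<dots> < \<infinity>" by simp
  finally show ?thesis
    using B_ap_peak fourier_exponents_peak by (simp add: BS_space_def B_ap_spec_def)
qed

lemma best_approx_peak: "ennreal max_weight \<le> best_approx lam M n (peak_function \<epsilon>)"
proof (cases "best_approx lam M n (peak_function \<epsilon>)")
  case (real r)
  have "nat (int n - 1) = n - 1" by simp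
  then have one: "fourier_coeff (peak_function \<epsilon>) (lam (int n)) = 1"
    using n by (simp add: fourier_coeff_peak peak_coeff_def)
  have "max_weight \<le> r"
    unfolding max_weight_def
  proof (rule cSUP_least[OF weights_nonempty[OF M]])
    fix \<gamma> assume "\<gamma> \<in> weights M"
    from weight_le_best_approx[OF lam n B_ap_peak this] show "\<gamma> (int n) \<le> r"
      using real by (simp add: one)
  qed
  then show ?thesis using real by (simp add: ennreal_leI)
qed simp

text \<open>
  For \<open>\<bar>h\<bar> \<le> u / lam n\<close> the argument \<open>lam n * h\<close> stays in \<open>[-u, u]\<close>, where \<open>smooth_phi\<close> is largest at
  the endpoints since \<open>u \<le> pi\<close>. So the peak contributes \<open>smooth_phi \<alpha> u\<close> to the modulus; at the
  other frequencies \<open>smooth_phi\<close> is bounded by \<open>2 powr \<alpha>\<close>.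
\<close>

lemma modulus_integral_peak:
  assumes \<alpha>: "\<alpha> > 0"
  shows "modulus_integral lam M \<alpha> n (peak_function \<epsilon>)
    \<le> ennreal (max_weight * (2 powr (\<alpha> / 2) * cos_powr_integral (\<alpha> / 2) 1) + 2 powr \<alpha> * \<epsilon> * 2)"
proof -
  have modulus: "modulus_smoothness lam M \<alpha> (peak_function \<epsilon>) (u / lam (int n))
      \<le> ennreal (max_weight * smooth_phi \<alpha> u + 2 powr \<alpha> * \<epsilon>)" if u: "u \<in> {0..pi}" for u
    unfolding modulus_smoothness_def
  proof (intro SUP_least)
    fix h \<gamma> assume h: "h \<in> {h. \<bar>h\<bar> \<le> u / lam (int n)}" and \<gamma>: "\<gamma> \<in> weights M"
    have "\<bar>lam (int n) * h\<bar> \<le> u"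
      using h lam_pos[OF lam n] by (simp add: abs_mult pos_le_divide_eq mult.commute)
    then have "smooth_phi \<alpha> (lam (int n) * h) \<le> smooth_phi \<alpha> u"
      using u by (intro smooth_phi_mono[OF \<alpha>]) auto
    then show "(\<Sum>\<^sub>\<infinity>k. ennreal (\<gamma> k * smooth_phi \<alpha> (lam k * h) * cmod (fourier_coeff (peak_function \<epsilon>) (lam k))))
        \<le> ennreal (max_weight * smooth_phi \<alpha> u + 2 powr \<alpha> * \<epsilon>)"
      by (intro peak_sum_le[OF \<gamma>] smooth_phi_nonneg smooth_phi_le[OF \<alpha>])
  qed
  let ?g = "\<lambda>u. (max_weight * smooth_phi \<alpha> u + 2 powr \<alpha> * \<epsilon>) * sin u"
  have sin: "set_integrable lborel {0..pi} sin" "(LBINT u:{0..pi}. sin u) = 2"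
  proof -
    show int: "set_integrable lborel {0..pi} sin"
      unfolding set_integrable_def by (intro borel_integrable_compact compact_Icc continuous_intros)
    show "(LBINT u:{0..pi}. sin u) = 2"
      using set_borel_integral_eq_integral(2)[OF int] cos_moment_0[of 0] by (simp add: cos_moment_def)
  qed
  note phi = smooth_phi_integral[OF \<alpha>, of 1, simplified]
  have g: "?g = (\<lambda>u. max_weight * (smooth_phi \<alpha> u * sin u) + (2 powr \<alpha> * \<epsilon>) * sin u)"
    by (simp add: algebra_simps)
  have int: "set_integrable lborel {0..pi} ?g"
    unfolding g using phi(1) sin(1) by (intro set_integral_add set_integrable_mult_right) auto
  have "modulus_integral lam M \<alpha> n (peak_function \<epsilon>) \<le> (\<integral>\<^sup>+u\<in>{0..pi}. ennreal (?g u) \<partial>lborel)"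
    unfolding modulus_integral_def
  proof (rule nn_set_integral_mono_on)
    fix u :: real assume u: "u \<in> {0..pi}"
    show "modulus_smoothness lam M \<alpha> (peak_function \<epsilon>) (u / lam (int n)) * ennreal (sin u) \<le> ennreal (?g u)"
      using mult_right_mono[OF modulus[OF u], of "ennreal (sin u)"] u
      by (simp add: ennreal_mult'' sin_ge_zero)
  qed
  also have "\<dots> = ennreal (LBINT u:{0..pi}. ?g u)"
    using max_weight_pos \<epsilon>
    by (intro nn_set_integral_eq int) (auto intro!: mult_nonneg_nonneg add_nonneg_nonneg smooth_phi_nonneg sin_ge_zero)
  also have "(LBINT u:{0..pi}. ?g u)
      = max_weight * (2 powr (\<alpha> / 2) * cos_powr_integral (\<alpha> / 2) 1) + 2 powr \<alpha> * \<epsilon> * 2"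
    unfolding g using phi sin by (subst set_integral_add) auto
  finally show ?thesis .
qed

end

text \<open>
  As \<open>\<epsilon>\<close> tends to 0, the integral of the modulus of the peak function is at most about \<open>max_weight\<close>
  times the factor \<open>2 powr (\<alpha> / 2) * cos_powr_integral (\<alpha> / 2) 1\<close>, while its best approximation
  remains at least \<open>max_weight\<close>. So a valid constant is at least the reciprocal of this factor.
\<close>

lemma constant_lower_bound:
  assumes \<alpha>: "\<alpha> > 0" and c: "c * (2 powr (\<alpha> / 2) * cos_powr_integral (\<alpha> / 2) 1) < 1"
  shows "\<exists>f\<in>BS_space lam M. full_fourier_series lam f \<and>
           ennreal c * modulus_integral lam M \<alpha> n f < best_approx lam M n f"
proof -
  define K where "K = 2 powr (\<alpha> / 2) * cos_powr_integral (\<alpha> / 2) 1"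
  define D where "D = 2 powr \<alpha> * 2"
  \<comment> \<open>A negative constant acts as 0, because \<open>ennreal\<close> truncates.\<close>
  define d where "d = max c 0"
  have D: "D > 0" and d: "d \<ge> 0" "ennreal c = ennreal d" "d * K < 1"
    using c by (auto simp: D_def d_def K_def max_def ennreal_neg)
  note s = max_weight_pos
  have pos: "d * D + 1 > 0" using d D by (simp add: add_nonneg_pos)
  define \<epsilon> where "\<epsilon> = max_weight * (1 - d * K) / (d * D + 1)"
  have \<epsilon>: "\<epsilon> > 0" using s d pos by (simp add: \<epsilon>_def)
  have "\<epsilon> * (d * D + 1) = max_weight * (1 - d * K)"
    using pos by (simp add: \<epsilon>_def)
  then have "d * D * \<epsilon> < max_weight * (1 - d * K)"
    using \<epsilon> by (simp add: algebra_simps)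
  then have lt: "d * (max_weight * K + D * \<epsilon>) < max_weight"
    by (simp add: algebra_simps)
  have "ennreal c * modulus_integral lam M \<alpha> n (peak_function \<epsilon>) \<le> ennreal d * ennreal (max_weight * K + D * \<epsilon>)"
    unfolding d(2) K_def D_def using modulus_integral_peak[OF \<epsilon> \<alpha>]
    by (intro mult_left_mono) (auto simp: mult_ac)
  also have "\<dots> = ennreal (d * (max_weight * K + D * \<epsilon>))"
    using d by (simp add: ennreal_mult')
  also have "\<dots> < ennreal max_weight"
    using s lt by (rule ennreal_lessI)
  also have "\<dots> \<le> best_approx lam M n (peak_function \<epsilon>)"
    by (rule best_approx_peak[OF \<epsilon>])
  finally show ?thesis
    using peak_in_space[OF \<epsilon>] full_peak[OF \<epsilon>] by blast
qed

end

section \<open>The Jackson type inequality and its best constant\<close>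

theorem corollary3p1:
  fixes lam :: "int \<Rightarrow> real" and M :: "int \<Rightarrow> real \<Rightarrow> real"
    and n :: nat and \<alpha> :: real
  assumes "exponent_sequence lam"
    and "\<forall>k. orlicz_function (M k)"
    and "n \<ge> 1" and "\<alpha> > 0"
  shows "(\<forall>f\<in>BS_space lam M. full_fourier_series lam f \<longrightarrow>
            best_approx lam M n f
              \<le> ennreal (1 / (2 powr (\<alpha> / 2) * I_const lam n (\<alpha> / 2))) * modulus_integral lam M \<alpha> n f)
       \<and> (\<alpha> / 2 \<in> \<nat> \<longrightarrow>
            I_const lam n (\<alpha> / 2) = 2 powr (\<alpha> / 2 + 1) / (\<alpha> / 2 + 1)
          \<and> (\<forall>c < (\<alpha> / 2 + 1) / 2 powr (\<alpha> + 1).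
               \<not> (\<forall>f\<in>BS_space lam M. full_fourier_series lam f \<longrightarrow>
                     best_approx lam M n f \<le> ennreal c * modulus_integral lam M \<alpha> n f)))"
proof (intro conjI ballI impI allI)
  fix f assume "f \<in> BS_space lam M"
  then show "best_approx lam M n f
      \<le> ennreal (1 / (2 powr (\<alpha> / 2) * I_const lam n (\<alpha> / 2))) * modulus_integral lam M \<alpha> n f"
    using direct_inequality[OF assms(1,3,4)] by (simp add: BS_space_def B_ap_spec_def)
next
  assume "\<alpha> / 2 \<in> \<nat>"
  then obtain m where m: "\<alpha> / 2 = real m" by (auto elim: Nats_cases)
  then have m1: "m \<ge> 1" using assms(4) by (cases m) auto
  then show "I_const lam n (\<alpha> / 2) = 2 powr (\<alpha> / 2 + 1) / (\<alpha> / 2 + 1)"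
    unfolding m by (rule I_const_of_nat[OF assms(1,3)])
  fix c assume c: "c < (\<alpha> / 2 + 1) / 2 powr (\<alpha> + 1)"
  have "2 powr (\<alpha> / 2) * cos_powr_integral (\<alpha> / 2) 1 = 2 powr (\<alpha> / 2) * (2 powr (\<alpha> / 2 + 1) / (\<alpha> / 2 + 1))"
    unfolding m cos_powr_integral_of_nat[OF m1] cos_moment_1 by (simp add: powr_add powr_realpow)
  also have "\<dots> = 2 powr (\<alpha> + 1) / (\<alpha> / 2 + 1)"
    by (simp flip: powr_add)
  finally have K: "2 powr (\<alpha> / 2) * cos_powr_integral (\<alpha> / 2) 1 = 2 powr (\<alpha> + 1) / (\<alpha> / 2 + 1)" .
  have "c * 2 powr (\<alpha> + 1) < \<alpha> / 2 + 1"
    using c by (simp add: pos_less_divide_eq)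
  then have "c * (2 powr (\<alpha> / 2) * cos_powr_integral (\<alpha> / 2) 1) < 1"
    unfolding K using assms(4) by (simp add: divide_less_eq)
  from constant_lower_bound[OF assms(1,3,2,4) this]
  show "\<not> (\<forall>f\<in>BS_space lam M. full_fourier_series lam f \<longrightarrow>
                     best_approx lam M n f \<le> ennreal c * modulus_integral lam M \<alpha> n f)"
    by (auto simp: not_le)
qed

end
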